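(* Let $Q$ be a quasigroup, let $H=\{H_p\}_{p\in Q}$ be a $Q$-graded Hopf quasigroup, and let $(M,\varphi,\rho)$ be a $Q$-graded $H$-Hopf quasimodule, with action $\varphi_{p,q}(h\otimes m)=h\cdot m$ and coactions $\rho_q$. For $p,q\in Q$ define $\vartriangleright_{p,q}:H_p\otimes M_q\to M_{pq}$ by $$h\vartriangleright m=(h\,m_{(-2)})\cdot\bigl(S_q(m_{(-1)})\cdot m_{(0)}\bigr),\qquad h\in H_p,\ m\in M_q.$$ Then $(M,\vartriangleright,\rho)$, i.e. the same family $M$ with the same coactions $\rho$ and with the action $\varphi$ replaced by $\vartriangleright=\{\vartriangleright_{p,q}\}_{p,q\in Q}$, is a $Q$-graded $H$-Hopf quasimodule.
   Context: Fix a field $k$; all vector spaces, linear maps and tensor products are over $k$. A quasigroup is a set $Q$ with a (not necessarily associative) product and a two-sided identity $e$ such that for each $p\in Q$ there is $p^{-1}\in Q$ with $p^{-1}(pq)=q$ and $(qp)p^{-1}=q$ for all $q\in Q$ (then inverses are unique, $(p^{-1})^{-1}=p$ and $(pq)^{-1}=q^{-1}p^{-1}$). Graded components whose indices are equal in $Q$ are the same space. A $Q$-graded Hopf quasigroup $H$ consists of: a family $\{H_p\}_{p\in Q}$ of vector spaces with linear maps $m_{p,q}:H_p\otimes H_q\to H_{pq}$, written $hg=m_{p,q}(h\otimes g)$ (not assumed associative), and a linear map $\mu:k\to H_e$ with $1=\mu(1_k)$ satisfying $h1=h=1h$; on each $H_p$ a coassociative counital coalgebra structure $(\Delta_p,\epsilon_p)$,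 written $\Delta_p(h)=h_{(1)}\otimes h_{(2)}$ (summation omitted), such that all $m_{p,q}$ and $\mu$ are coalgebra maps; and linear maps $S_p:H_p\to H_{p^{-1}}$ (antipode) such that for all $p,q\in Q$, $h\in H_p$, $g\in H_q$: $S_p(h_{(1)})(h_{(2)}g)=\epsilon_p(h)g=h_{(1)}(S_p(h_{(2)})g)$ and $(gS_p(h_{(1)}))h_{(2)}=g\epsilon_p(h)=(gh_{(1)})S_p(h_{(2)})$. A $Q$-graded $H$-quasimodule is a family $M=\{M_q\}_{q\in Q}$ of vector spaces with linear maps $\varphi_{p,q}:H_p\otimes M_q\to M_{pq}$, written $h\cdot m$, such that $1\cdot m=m$ and $h_{(1)}\cdot(S_p(h_{(2)})\cdot m)=S_p(h_{(1)})\cdot(h_{(2)}\cdot m)=\epsilon_p(h)m$ for all $p,q\in Q$, $h\in H_p$, $m\in M_q$. A $Q$-graded $H$-Hopf quasimodule is a $Q$-graded $H$-quasimodule $M$ such that each $M_q$ is a coassociative counital left $H_q$-comodule via $\rho_q:M_q\to H_q\otimes M_q$, $\rho_q(m)=m_{(-1)}\otimes m_{(0)}$, and $\rho_{pq}(h\cdot m)=h_{(1)}m_{(-1)}\otimes h_{(2)}\cdot m_{(0)}$ for all $p,q\in Q$, $h\in H_p$, $m\in M_q$. The iterated coaction is written $m_{(-2)}\otimes m_{(-1)}\otimes m_{(0)}=(\Delta_q\otimes I)\rho_q(m)$. *)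

theory Defs
  imports "HOL.Hull" "HOL-Algebra.AbelCoset" "HOL-Algebra.Module"
begin

section \<open>Tensor products of vector spaces\<close>

text \<open>A vector space over the field \<^term>\<open>K\<close> is an object \<^term>\<open>V\<close> with
  \<^prop>\<open>module K V\<close>, where \<^prop>\<open>field K\<close>. The fields \<^const>\<open>mult\<close> and \<^const>\<open>one\<close>
  that the record type of modules inherits from rings carry no meaning for modules.\<close>

definition linear_maps ::
  "('k, 'z) ring_scheme \<Rightarrow> ('k, 'v) module \<Rightarrow> ('k, 'w) module \<Rightarrow> ('v \<Rightarrow> 'w) set" where
  "linear_maps K V W = {f \<in> carrier V \<rightarrow> carrier W.
     (\<forall>x\<in>carrier V. \<forall>y\<in>carrier V. f (x \<oplus>\<^bsub>V\<^esub> y) = f x \<oplus>\<^bsub>W\<^esub> f y) \<and>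
     (\<forall>a\<in>carrier K. \<forall>x\<in>carrier V. f (a \<odot>\<^bsub>V\<^esub> x) = a \<odot>\<^bsub>W\<^esub> f x)}"

definition self_module :: "('k, 'z) ring_scheme \<Rightarrow> ('k, 'k) module" where
  "self_module K = \<lparr>carrier = carrier K, mult = mult K, one = one K, zero = zero K,
     add = add K, smult = mult K\<rparr>"

definition free_module :: "('k, 'z) ring_scheme \<Rightarrow> 'x set \<Rightarrow> ('k, 'x \<Rightarrow> 'k) module" where
  "free_module K X = \<lparr>
     carrier = {f. (\<forall>x\<in>X. f x \<in> carrier K) \<and> (\<forall>x. x \<notin> X \<longrightarrow> f x = \<zero>\<^bsub>K\<^esub>) \<and>
                   finite {x. f x \<noteq> \<zero>\<^bsub>K\<^esub>}},
     mult = undefined, one = undefined,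
     zero = (\<lambda>x. \<zero>\<^bsub>K\<^esub>),
     add = (\<lambda>f g x. f x \<oplus>\<^bsub>K\<^esub> g x),
     smult = (\<lambda>a f x. a \<otimes>\<^bsub>K\<^esub> f x)\<rparr>"

definition free_gen :: "('k, 'z) ring_scheme \<Rightarrow> 'x \<Rightarrow> 'x \<Rightarrow> 'k" where
  "free_gen K x = (\<lambda>y. if y = x then \<one>\<^bsub>K\<^esub> else \<zero>\<^bsub>K\<^esub>)"

definition quotient_module ::
  "('k, 'z) ring_scheme \<Rightarrow> ('k, 'v) module \<Rightarrow> 'v set \<Rightarrow> ('k, 'v set) module" where
  "quotient_module K F N = \<lparr>
     carrier = a_rcosets\<^bsub>F\<^esub> N,
     mult = undefined, one = undefined,
     zero = N,
     add = set_add F,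
     smult = (\<lambda>a X. \<Union>x\<in>X. N +>\<^bsub>F\<^esub> (a \<odot>\<^bsub>F\<^esub> x))\<rparr>"

definition tensor_relations ::
  "('k, 'z) ring_scheme \<Rightarrow> ('k, 'v) module \<Rightarrow> ('k, 'w) module \<Rightarrow> ('v \<times> 'w \<Rightarrow> 'k) set" where
  "tensor_relations K V W = (let F = free_module K (carrier V \<times> carrier W) in
     {free_gen K (v \<oplus>\<^bsub>V\<^esub> v', w) \<ominus>\<^bsub>F\<^esub> (free_gen K (v, w) \<oplus>\<^bsub>F\<^esub> free_gen K (v', w)) | v v' w.
        v \<in> carrier V \<and> v' \<in> carrier V \<and> w \<in> carrier W} \<union>
     {free_gen K (v, w \<oplus>\<^bsub>W\<^esub> w') \<ominus>\<^bsub>F\<^esub> (free_gen K (v, w) \<oplus>\<^bsub>F\<^esub> free_gen K (v, w')) | v w w'.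
        v \<in> carrier V \<and> w \<in> carrier W \<and> w' \<in> carrier W} \<union>
     {free_gen K (a \<odot>\<^bsub>V\<^esub> v, w) \<ominus>\<^bsub>F\<^esub> a \<odot>\<^bsub>F\<^esub> free_gen K (v, w) | a v w.
        a \<in> carrier K \<and> v \<in> carrier V \<and> w \<in> carrier W} \<union>
     {free_gen K (v, a \<odot>\<^bsub>W\<^esub> w) \<ominus>\<^bsub>F\<^esub> a \<odot>\<^bsub>F\<^esub> free_gen K (v, w) | a v w.
        a \<in> carrier K \<and> v \<in> carrier V \<and> w \<in> carrier W})"

definition tensor_null ::
  "('k, 'z) ring_scheme \<Rightarrow> ('k, 'v) module \<Rightarrow> ('k, 'w) module \<Rightarrow> ('v \<times> 'w \<Rightarrow> 'k) set" where
  "tensor_null K V W =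
     (\<lambda>N. submodule N K (free_module K (carrier V \<times> carrier W))) hull tensor_relations K V W"

definition tensor ::
  "('k, 'z) ring_scheme \<Rightarrow> ('k, 'v) module \<Rightarrow> ('k, 'w) module
    \<Rightarrow> ('k, ('v \<times> 'w \<Rightarrow> 'k) set) module" where
  "tensor K V W =
     quotient_module K (free_module K (carrier V \<times> carrier W)) (tensor_null K V W)"

definition pure ::
  "('k, 'z) ring_scheme \<Rightarrow> ('k, 'v) module \<Rightarrow> ('k, 'w) module
    \<Rightarrow> 'v \<Rightarrow> 'w \<Rightarrow> ('v \<times> 'w \<Rightarrow> 'k) set" where
  "pure K V W v w =
     tensor_null K V W +>\<^bsub>free_module K (carrier V \<times> carrier W)\<^esub> free_gen K (v, w)"

text \<open>The value at \<^term>\<open>t\<close> of the linear map from \<^term>\<open>tensor K V W\<close> to \<^term>\<open>U\<close> induced by a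
  bilinear map \<^term>\<open>f\<close>: if \<open>t\<close> is the sum of the \<open>v\<^sub>i \<otimes> w\<^sub>i\<close>, it is the sum of
  the \<open>f v\<^sub>i w\<^sub>i\<close>. The result is independent of the chosen representative of the coset \<^term>\<open>t\<close>
  only for bilinear \<^term>\<open>f\<close>. Sweedler expressions are read through this: an expression in
  \<open>h\<^sub>(\<^sub>1\<^sub>)\<close>, \<open>h\<^sub>(\<^sub>2\<^sub>)\<close> is the lift of the expression with the two legs as
  variables, applied to \<open>\<Delta>(h)\<close>.\<close>

definition tensor_lift ::
  "('k, 'z) ring_scheme \<Rightarrow> ('k, 'v) module \<Rightarrow> ('k, 'w) module \<Rightarrow> ('k, 'u) module
    \<Rightarrow> ('v \<Rightarrow> 'w \<Rightarrow> 'u) \<Rightarrow> ('v \<times> 'w \<Rightarrow> 'k) set \<Rightarrow> 'u" where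
  "tensor_lift K V W U f t = (let x = (SOME x. x \<in> t) in
     \<Oplus>\<^bsub>U\<^esub>p\<in>{p \<in> carrier V \<times> carrier W. x p \<noteq> \<zero>\<^bsub>K\<^esub>}. x p \<odot>\<^bsub>U\<^esub> f (fst p) (snd p))"

definition tensor_map ::
  "('k, 'z) ring_scheme \<Rightarrow> ('k, 'v) module \<Rightarrow> ('k, 'w) module
    \<Rightarrow> ('k, 'v') module \<Rightarrow> ('k, 'w') module \<Rightarrow> ('v \<Rightarrow> 'v') \<Rightarrow> ('w \<Rightarrow> 'w')
    \<Rightarrow> ('v \<times> 'w \<Rightarrow> 'k) set \<Rightarrow> ('v' \<times> 'w' \<Rightarrow> 'k) set" where
  "tensor_map K V W V' W' f g =
     tensor_lift K V W (tensor K V' W') (\<lambda>v w. pure K V' W' (f v) (g w))"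

text \<open>The canonical map from \<open>(U \<otimes> V) \<otimes> W\<close> to \<open>U \<otimes> (V \<otimes> W)\<close>.\<close>

definition tensor_assoc ::
  "('k, 'z) ring_scheme \<Rightarrow> ('k, 'u) module \<Rightarrow> ('k, 'v) module \<Rightarrow> ('k, 'w) module
    \<Rightarrow> (('u \<times> 'v \<Rightarrow> 'k) set \<times> 'w \<Rightarrow> 'k) set \<Rightarrow> ('u \<times> ('v \<times> 'w \<Rightarrow> 'k) set \<Rightarrow> 'k) set" where
  "tensor_assoc K U V W =
     tensor_lift K (tensor K U V) W (tensor K U (tensor K V W))
       (\<lambda>t w. tensor_lift K U V (tensor K U (tensor K V W))
          (\<lambda>u v. pure K U (tensor K V W) u (pure K V W v w)) t)"


section \<open>Coalgebras and comodules\<close>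

locale coalgebra =
  field K + module K C
  for K :: "('k, 'z) ring_scheme" and C :: "('k, 'c) module" +
  fixes \<Delta> :: "'c \<Rightarrow> ('c \<times> 'c \<Rightarrow> 'k) set" and \<epsilon> :: "'c \<Rightarrow> 'k"
  assumes comult_linear: "\<Delta> \<in> linear_maps K C (tensor K C C)"
    and counit_linear: "\<epsilon> \<in> linear_maps K C (self_module K)"
    and coassoc: "c \<in> carrier C \<Longrightarrow>
      tensor_assoc K C C C (tensor_map K C C (tensor K C C) C \<Delta> id (\<Delta> c)) =
      tensor_map K C C C (tensor K C C) id \<Delta> (\<Delta> c)"
    and counit_left: "c \<in> carrier C \<Longrightarrow> tensor_lift K C C C (\<lambda>a b. \<epsilon> a \<odot>\<^bsub>C\<^esub> b) (\<Delta> c) = c"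
    and counit_right: "c \<in> carrier C \<Longrightarrow> tensor_lift K C C C (\<lambda>a b. \<epsilon> b \<odot>\<^bsub>C\<^esub> a) (\<Delta> c) = c"

definition coalgebra_maps ::
  "('k, 'z) ring_scheme
    \<Rightarrow> ('k, 'c) module \<Rightarrow> ('c \<Rightarrow> ('c \<times> 'c \<Rightarrow> 'k) set) \<Rightarrow> ('c \<Rightarrow> 'k)
    \<Rightarrow> ('k, 'd) module \<Rightarrow> ('d \<Rightarrow> ('d \<times> 'd \<Rightarrow> 'k) set) \<Rightarrow> ('d \<Rightarrow> 'k) \<Rightarrow> ('c \<Rightarrow> 'd) set" where
  "coalgebra_maps K C \<Delta>C \<epsilon>C D \<Delta>D \<epsilon>D = {f \<in> linear_maps K C D.
     \<forall>c\<in>carrier C. \<Delta>D (f c) = tensor_map K C C D D f f (\<Delta>C c) \<and> \<epsilon>D (f c) = \<epsilon>C c}"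

text \<open>The tensor product coalgebra has comultiplication
  \<open>c \<otimes> d \<mapsto> (c\<^sub>(\<^sub>1\<^sub>) \<otimes> d\<^sub>(\<^sub>1\<^sub>)) \<otimes> (c\<^sub>(\<^sub>2\<^sub>) \<otimes> d\<^sub>(\<^sub>2\<^sub>))\<close> and counit
  \<open>c \<otimes> d \<mapsto> \<epsilon>(c) \<epsilon>(d)\<close>.\<close>

definition tensor_comult ::
  "('k, 'z) ring_scheme \<Rightarrow> ('k, 'c) module \<Rightarrow> ('c \<Rightarrow> ('c \<times> 'c \<Rightarrow> 'k) set)
    \<Rightarrow> ('k, 'd) module \<Rightarrow> ('d \<Rightarrow> ('d \<times> 'd \<Rightarrow> 'k) set)
    \<Rightarrow> ('c \<times> 'd \<Rightarrow> 'k) set \<Rightarrow> (('c \<times> 'd \<Rightarrow> 'k) set \<times> ('c \<times> 'd \<Rightarrow> 'k) set \<Rightarrow> 'k) set" where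
  "tensor_comult K C \<Delta>C D \<Delta>D = (let CD = tensor K C D; T = tensor K CD CD in
     tensor_lift K C D T (\<lambda>c d.
       tensor_lift K C C T (\<lambda>c1 c2.
         tensor_lift K D D T (\<lambda>d1 d2. pure K CD CD (pure K C D c1 d1) (pure K C D c2 d2))
           (\<Delta>D d)) (\<Delta>C c)))"

definition tensor_counit ::
  "('k, 'z) ring_scheme \<Rightarrow> ('k, 'c) module \<Rightarrow> ('c \<Rightarrow> 'k) \<Rightarrow> ('k, 'd) module \<Rightarrow> ('d \<Rightarrow> 'k)
    \<Rightarrow> ('c \<times> 'd \<Rightarrow> 'k) set \<Rightarrow> 'k" where
  "tensor_counit K C \<epsilon>C D \<epsilon>D =
     tensor_lift K C D (self_module K) (\<lambda>c d. \<epsilon>C c \<otimes>\<^bsub>K\<^esub> \<epsilon>D d)"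

definition base_comult :: "('k, 'z) ring_scheme \<Rightarrow> 'k \<Rightarrow> ('k \<times> 'k \<Rightarrow> 'k) set" where
  "base_comult K a = pure K (self_module K) (self_module K) a \<one>\<^bsub>K\<^esub>"

locale left_comodule =
  coalgebra K C \<Delta> \<epsilon> + V: module K V
  for K :: "('k, 'z) ring_scheme" and C :: "('k, 'c) module" and \<Delta> \<epsilon>
    and V :: "('k, 'v) module" +
  fixes \<rho> :: "'v \<Rightarrow> ('c \<times> 'v \<Rightarrow> 'k) set"
  assumes coact_linear: "\<rho> \<in> linear_maps K V (tensor K C V)"
    and coact_coassoc: "v \<in> carrier V \<Longrightarrow>
      tensor_assoc K C C V (tensor_map K C V (tensor K C C) V \<Delta> id (\<rho> v)) =
      tensor_map K C V C (tensor K C V) id \<rho> (\<rho> v)"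
    and coact_counit: "v \<in> carrier V \<Longrightarrow> tensor_lift K C V V (\<lambda>c x. \<epsilon> c \<odot>\<^bsub>V\<^esub> x) (\<rho> v) = v"


section \<open>Quasigroups and graded Hopf quasigroups\<close>

text \<open>The record type \<open>monoid\<close> is used only for its fields; associativity is not assumed.\<close>

locale quasigroup =
  fixes Q :: "('q, 'y) monoid_scheme" (structure)
  assumes mult_closed: "\<lbrakk>p \<in> carrier Q; q \<in> carrier Q\<rbrakk> \<Longrightarrow> p \<otimes> q \<in> carrier Q"
    and one_closed: "\<one> \<in> carrier Q"
    and left_one: "p \<in> carrier Q \<Longrightarrow> \<one> \<otimes> p = p"
    and right_one: "p \<in> carrier Q \<Longrightarrow> p \<otimes> \<one> = p"
    and inverse_exists: "p \<in> carrier Q \<Longrightarrow>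
      \<exists>p'\<in>carrier Q. \<forall>q\<in>carrier Q. p' \<otimes> (p \<otimes> q) = q \<and> (q \<otimes> p) \<otimes> p' = q"

definition qinv :: "('q, 'y) monoid_scheme \<Rightarrow> 'q \<Rightarrow> 'q" where
  "qinv Q p = (THE p'. p' \<in> carrier Q \<and>
     (\<forall>q\<in>carrier Q. p' \<otimes>\<^bsub>Q\<^esub> (p \<otimes>\<^bsub>Q\<^esub> q) = q \<and> (q \<otimes>\<^bsub>Q\<^esub> p) \<otimes>\<^bsub>Q\<^esub> p' = q))"

lemma (in quasigroup) qinv:
  assumes "p \<in> carrier Q"
  shows "qinv Q p \<in> carrier Q"
    and "q \<in> carrier Q \<Longrightarrow> qinv Q p \<otimes> (p \<otimes> q) = q"
    and "q \<in> carrier Q \<Longrightarrow> (q \<otimes> p) \<otimes> qinv Q p = q"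
proof -
  let ?P = "\<lambda>p'. p' \<in> carrier Q \<and>
    (\<forall>q\<in>carrier Q. p' \<otimes> (p \<otimes> q) = q \<and> (q \<otimes> p) \<otimes> p' = q)"
  obtain i where i: "?P i"
    using inverse_exists[OF assms] by blast
  have "j = i" if j: "?P j" for j
  proof -
    have "j \<otimes> (p \<otimes> i) = i" using i j by blast
    moreover have "p \<otimes> i = \<one>"
      using i one_closed left_one[OF assms] by metis
    ultimately show ?thesis
      using j right_one by metis
  qed
  then have "\<exists>!j. ?P j" using i by blast
  from theI'[OF this] have "?P (qinv Q p)"
    unfolding qinv_def .
  then show "qinv Q p \<in> carrier Q"
    and "q \<in> carrier Q \<Longrightarrow> qinv Q p \<otimes> (p \<otimes> q) = q"
    and "q \<in> carrier Q \<Longrightarrow> (q \<otimes> p) \<otimes> qinv Q p = q" by blast+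
qed

text \<open>The structure maps \<open>m p q\<close> and (below) \<open>\<phi> p q\<close> are linear maps on tensor products; \<open>prd p q h g\<close> and
  \<open>act p q h x\<close> are their values at \<open>h \<otimes> g\<close> and \<open>h \<otimes> x\<close>, written \<open>h g\<close> and \<open>h \<cdot> x\<close> in
  the literature. Components with equal index coincide, e.g. \<open>H (p\<^sup>-\<^sup>1 (p q)) = H q\<close>.\<close>

locale graded_product =
  fixes K :: "('k, 'z) ring_scheme"
    and H :: "'q \<Rightarrow> ('k, 'h) module"
    and m :: "'q \<Rightarrow> 'q \<Rightarrow> ('h \<times> 'h \<Rightarrow> 'k) set \<Rightarrow> 'h"
begin

abbreviation prd :: "'q \<Rightarrow> 'q \<Rightarrow> 'h \<Rightarrow> 'h \<Rightarrow> 'h" where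
  "prd p q h g \<equiv> m p q (pure K (H p) (H q) h g)"

end

locale graded_hopf_quasigroup =
  quasigroup Q + field K + graded_product K H m
  for Q :: "('q, 'y) monoid_scheme" and K :: "('k, 'z) ring_scheme"
    and H :: "'q \<Rightarrow> ('k, 'h) module" and m +
  fixes \<mu> :: "'k \<Rightarrow> 'h"
    and \<Delta> :: "'q \<Rightarrow> 'h \<Rightarrow> ('h \<times> 'h \<Rightarrow> 'k) set"
    and \<epsilon> :: "'q \<Rightarrow> 'h \<Rightarrow> 'k"
    and S :: "'q \<Rightarrow> 'h \<Rightarrow> 'h"
  assumes component_coalgebra: "p \<in> carrier Q \<Longrightarrow> coalgebra K (H p) (\<Delta> p) (\<epsilon> p)"
    and mult_coalgebra_map: "\<lbrakk>p \<in> carrier Q; q \<in> carrier Q\<rbrakk> \<Longrightarrow>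
      m p q \<in> coalgebra_maps K
        (tensor K (H p) (H q)) (tensor_comult K (H p) (\<Delta> p) (H q) (\<Delta> q))
          (tensor_counit K (H p) (\<epsilon> p) (H q) (\<epsilon> q))
        (H (p \<otimes>\<^bsub>Q\<^esub> q)) (\<Delta> (p \<otimes>\<^bsub>Q\<^esub> q)) (\<epsilon> (p \<otimes>\<^bsub>Q\<^esub> q))"
    and unit_coalgebra_map:
      "\<mu> \<in> coalgebra_maps K (self_module K) (base_comult K) id (H \<one>\<^bsub>Q\<^esub>) (\<Delta> \<one>\<^bsub>Q\<^esub>) (\<epsilon> \<one>\<^bsub>Q\<^esub>)"
    and unit_right: "\<lbrakk>p \<in> carrier Q; h \<in> carrier (H p)\<rbrakk> \<Longrightarrow> prd p \<one>\<^bsub>Q\<^esub> h (\<mu> \<one>\<^bsub>K\<^esub>) = h"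
    and unit_left: "\<lbrakk>p \<in> carrier Q; h \<in> carrier (H p)\<rbrakk> \<Longrightarrow> prd \<one>\<^bsub>Q\<^esub> p (\<mu> \<one>\<^bsub>K\<^esub>) h = h"
    and antipode_linear: "p \<in> carrier Q \<Longrightarrow> S p \<in> linear_maps K (H p) (H (qinv Q p))"
    and antipode_left_1:
      "\<lbrakk>p \<in> carrier Q; q \<in> carrier Q; h \<in> carrier (H p); g \<in> carrier (H q)\<rbrakk> \<Longrightarrow>
        tensor_lift K (H p) (H p) (H q)
          (\<lambda>a b. prd (qinv Q p) (p \<otimes>\<^bsub>Q\<^esub> q) (S p a) (prd p q b g)) (\<Delta> p h) = \<epsilon> p h \<odot>\<^bsub>H q\<^esub> g"
    and antipode_left_2:
      "\<lbrakk>p \<in> carrier Q; q \<in> carrier Q; h \<in> carrier (H p); g \<in> carrier (H q)\<rbrakk> \<Longrightarrow>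
        tensor_lift K (H p) (H p) (H q)
          (\<lambda>a b. prd p (qinv Q p \<otimes>\<^bsub>Q\<^esub> q) a (prd (qinv Q p) q (S p b) g)) (\<Delta> p h) =
        \<epsilon> p h \<odot>\<^bsub>H q\<^esub> g"
    and antipode_right_1:
      "\<lbrakk>p \<in> carrier Q; q \<in> carrier Q; h \<in> carrier (H p); g \<in> carrier (H q)\<rbrakk> \<Longrightarrow>
        tensor_lift K (H p) (H p) (H q)
          (\<lambda>a b. prd (q \<otimes>\<^bsub>Q\<^esub> qinv Q p) p (prd q (qinv Q p) g (S p a)) b) (\<Delta> p h) =
        \<epsilon> p h \<odot>\<^bsub>H q\<^esub> g"
    and antipode_right_2:
      "\<lbrakk>p \<in> carrier Q; q \<in> carrier Q; h \<in> carrier (H p); g \<in> carrier (H q)\<rbrakk> \<Longrightarrow>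
        tensor_lift K (H p) (H p) (H q)
          (\<lambda>a b. prd (q \<otimes>\<^bsub>Q\<^esub> p) (qinv Q p) (prd q p g a) (S p b)) (\<Delta> p h) = \<epsilon> p h \<odot>\<^bsub>H q\<^esub> g"


section \<open>Graded quasimodules and Hopf quasimodules\<close>

locale graded_action =
  fixes K :: "('k, 'z) ring_scheme"
    and H :: "'q \<Rightarrow> ('k, 'h) module"
    and M :: "'q \<Rightarrow> ('k, 'm) module"
    and \<phi> :: "'q \<Rightarrow> 'q \<Rightarrow> ('h \<times> 'm \<Rightarrow> 'k) set \<Rightarrow> 'm"
begin

abbreviation act :: "'q \<Rightarrow> 'q \<Rightarrow> 'h \<Rightarrow> 'm \<Rightarrow> 'm" where
  "act p q h x \<equiv> \<phi> p q (pure K (H p) (M q) h x)"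

end

locale graded_quasimodule =
  graded_hopf_quasigroup Q K H m \<mu> \<Delta> \<epsilon> S + graded_action K H M \<phi>
  for Q :: "('q, 'y) monoid_scheme" and K :: "('k, 'z) ring_scheme"
    and H :: "'q \<Rightarrow> ('k, 'h) module" and m \<mu> \<Delta> \<epsilon> S
    and M :: "'q \<Rightarrow> ('k, 'm) module" and \<phi> +
  assumes component_module: "q \<in> carrier Q \<Longrightarrow> module K (M q)"
    and action_linear: "\<lbrakk>p \<in> carrier Q; q \<in> carrier Q\<rbrakk> \<Longrightarrow>
      \<phi> p q \<in> linear_maps K (tensor K (H p) (M q)) (M (p \<otimes>\<^bsub>Q\<^esub> q))"
    and action_unit: "\<lbrakk>q \<in> carrier Q; x \<in> carrier (M q)\<rbrakk> \<Longrightarrow> act \<one>\<^bsub>Q\<^esub> q (\<mu> \<one>\<^bsub>K\<^esub>) x = x"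
    and action_antipode_1:
      "\<lbrakk>p \<in> carrier Q; q \<in> carrier Q; h \<in> carrier (H p); x \<in> carrier (M q)\<rbrakk> \<Longrightarrow>
        tensor_lift K (H p) (H p) (M q)
          (\<lambda>a b. act p (qinv Q p \<otimes>\<^bsub>Q\<^esub> q) a (act (qinv Q p) q (S p b) x)) (\<Delta> p h) =
        \<epsilon> p h \<odot>\<^bsub>M q\<^esub> x"
    and action_antipode_2:
      "\<lbrakk>p \<in> carrier Q; q \<in> carrier Q; h \<in> carrier (H p); x \<in> carrier (M q)\<rbrakk> \<Longrightarrow>
        tensor_lift K (H p) (H p) (M q)
          (\<lambda>a b. act (qinv Q p) (p \<otimes>\<^bsub>Q\<^esub> q) (S p a) (act p q b x)) (\<Delta> p h) = \<epsilon> p h \<odot>\<^bsub>M q\<^esub> x"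

locale graded_hopf_quasimodule =
  graded_quasimodule Q K H m \<mu> \<Delta> \<epsilon> S M \<phi>
  for Q :: "('q, 'y) monoid_scheme" and K :: "('k, 'z) ring_scheme"
    and H :: "'q \<Rightarrow> ('k, 'h) module" and m \<mu> \<Delta> \<epsilon> S
    and M :: "'q \<Rightarrow> ('k, 'm) module" and \<phi> +
  fixes \<rho> :: "'q \<Rightarrow> 'm \<Rightarrow> ('h \<times> 'm \<Rightarrow> 'k) set"
  assumes component_comodule: "q \<in> carrier Q \<Longrightarrow>
      left_comodule K (H q) (\<Delta> q) (\<epsilon> q) (M q) (\<rho> q)"
    and coaction_action:
      "\<lbrakk>p \<in> carrier Q; q \<in> carrier Q; h \<in> carrier (H p); x \<in> carrier (M q)\<rbrakk> \<Longrightarrow>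
        \<rho> (p \<otimes>\<^bsub>Q\<^esub> q) (act p q h x) =
        (let T = tensor K (H (p \<otimes>\<^bsub>Q\<^esub> q)) (M (p \<otimes>\<^bsub>Q\<^esub> q)) in
          tensor_lift K (H p) (H p) T (\<lambda>h1 h2.
            tensor_lift K (H q) (M q) T (\<lambda>c y.
              pure K (H (p \<otimes>\<^bsub>Q\<^esub> q)) (M (p \<otimes>\<^bsub>Q\<^esub> q)) (prd p q h1 c) (act p q h2 y))
              (\<rho> q x)) (\<Delta> p h))"

begin

text \<open>The modified action sends \<open>h \<otimes> x\<close> to
  \<open>(h x\<^sub>(\<^sub>-\<^sub>2\<^sub>)) \<cdot> (S\<^sub>q(x\<^sub>(\<^sub>-\<^sub>1\<^sub>)) \<cdot> x\<^sub>(\<^sub>0\<^sub>))\<close>. Its value lies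
  in the component \<open>M ((p q) (q\<^sup>-\<^sup>1 q))\<close>, which is \<open>M (p q)\<close>.\<close>

definition modified_action :: "'q \<Rightarrow> 'q \<Rightarrow> ('h \<times> 'm \<Rightarrow> 'k) set \<Rightarrow> 'm" where
  "modified_action p q = (let U = M (p \<otimes>\<^bsub>Q\<^esub> q) in
     tensor_lift K (H p) (M q) U (\<lambda>h x.
       tensor_lift K (tensor K (H q) (H q)) (M q) U (\<lambda>t x0.
         tensor_lift K (H q) (H q) U (\<lambda>a b.
           act (p \<otimes>\<^bsub>Q\<^esub> q) (qinv Q q \<otimes>\<^bsub>Q\<^esub> q) (prd p q h a) (act (qinv Q q) q (S q b) x0)) t)
         (tensor_map K (H q) (M q) (tensor K (H q) (H q)) (M q) (\<Delta> q) id (\<rho> q x))))"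

end

end

theory Submission
  imports Defs
begin

text \<open>Put \<open>\<pi>(x) = S(x\<^sub>(\<^sub>-\<^sub>1\<^sub>)) \<cdot> x\<^sub>(\<^sub>0\<^sub>)\<close>. Then \<open>\<pi>(x)\<close> is
  coinvariant, i.e. \<open>\<rho>(\<pi>(x)) = 1 \<otimes> \<pi>(x)\<close>, and \<open>x = x\<^sub>(\<^sub>-\<^sub>1\<^sub>) \<cdot> \<pi>(x\<^sub>(\<^sub>0\<^sub>))\<close>, so
  \<open>M\<close> is spanned by the elements \<open>a \<cdot> w\<close> with \<open>w\<close> coinvariant. On these the modified action is
  \<open>h \<rhd> (a \<cdot> w) = (h a) \<cdot> w\<close>, because \<open>\<rho>(a \<cdot> w) = a\<^sub>(\<^sub>1\<^sub>) \<otimes> a\<^sub>(\<^sub>2\<^sub>) \<cdot> w\<close> and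
  \<open>\<pi>(a \<cdot> w) = \<epsilon>(a) w\<close>. Every axiom for \<open>\<rhd>\<close> thereby reduces to the corresponding property of
  multiplication in \<open>H\<close>.\<close>

section \<open>Linear and bilinear maps\<close>

text \<open>No axiom compares \<open>h \<cdot> (a \<cdot> w)\<close> with
  \<open>(h a) \<cdot> w\<close>. The modified action corrects this by collecting all products
  inside \<open>H\<close>, where the antipode axioms handle nested products without any
  reassociation. The two antipode axioms of the given action have different tasks:
  \<open>a1 \<cdot> (S(a2) \<cdot> y) = \<epsilon>(a) y\<close> recovers \<open>x\<close> from its
  projections, while \<open>S(a1) \<cdot> (a2 \<cdot> w) = \<epsilon>(a) w\<close> computes the
  projection of \<open>a \<cdot> w\<close>. The delicate claim is the coinvariance of
  \<open>\<pi>(x)\<close>: expanding \<open>\<rho>(S(a) \<cdot> y)\<close> brings in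
  \<open>\<Delta>(S(a))\<close>, for which the axioms give no formula. Coassociativity of the
  coaction lets it enter only as \<open>S(a1)\<^sub>1 a2 \<otimes> S(a1)\<^sub>2\<close>, and this
  combination can be computed. Formally, \<open>tensor_lift\<close> evaluates an arbitrary
  representative of a coset, so every Sweedler step carries a bilinearity condition; rule
  collections such as \<open>quasi_intros\<close> settle these by the shape of the
  expression.\<close>

lemma linear_mapsI:
  assumes "\<And>x. x \<in> carrier V \<Longrightarrow> f x \<in> carrier W"
    and "\<And>x y. \<lbrakk>x \<in> carrier V; y \<in> carrier V\<rbrakk> \<Longrightarrow> f (x \<oplus>\<^bsub>V\<^esub> y) = f x \<oplus>\<^bsub>W\<^esub> f y"
    and "\<And>a x. \<lbrakk>a \<in> carrier K; x \<in> carrier V\<rbrakk> \<Longrightarrow> f (a \<odot>\<^bsub>V\<^esub> x) = a \<odot>\<^bsub>W\<^esub> f x"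
  shows "f \<in> linear_maps K V W"
  using assms unfolding linear_maps_def by auto

lemma linear_mapsD:
  assumes "f \<in> linear_maps K V W"
  shows "x \<in> carrier V \<Longrightarrow> f x \<in> carrier W"
    and "\<lbrakk>x \<in> carrier V; y \<in> carrier V\<rbrakk> \<Longrightarrow> f (x \<oplus>\<^bsub>V\<^esub> y) = f x \<oplus>\<^bsub>W\<^esub> f y"
    and "\<lbrakk>a \<in> carrier K; x \<in> carrier V\<rbrakk> \<Longrightarrow> f (a \<odot>\<^bsub>V\<^esub> x) = a \<odot>\<^bsub>W\<^esub> f x"
  using assms unfolding linear_maps_def by auto

lemma linear_maps_id: "(\<lambda>x. x) \<in> linear_maps K V V"
  unfolding linear_maps_def by auto

lemma linear_maps_comp:
  assumes "g \<in> linear_maps K V W" "f \<in> linear_maps K U V"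
  shows "(\<lambda>x. g (f x)) \<in> linear_maps K U W"
  using assms unfolding linear_maps_def by (auto simp: Pi_iff)

text \<open>Curried like the integrand of \<open>tensor_lift\<close>. Membership is the condition
  that makes a lift well defined on cosets.\<close>

definition bilinear_maps ::
  "('k, 'z) ring_scheme \<Rightarrow> ('k, 'v) module \<Rightarrow> ('k, 'w) module \<Rightarrow> ('k, 'u) module
    \<Rightarrow> ('v \<Rightarrow> 'w \<Rightarrow> 'u) set" where
  "bilinear_maps K V W U = {f. (\<forall>v\<in>carrier V. f v \<in> linear_maps K W U) \<and>
     (\<forall>w\<in>carrier W. (\<lambda>v. f v w) \<in> linear_maps K V U)}"

lemma bilinear_mapsI:
  assumes "\<And>v. v \<in> carrier V \<Longrightarrow> f v \<in> linear_maps K W U"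
    and "\<And>w. w \<in> carrier W \<Longrightarrow> (\<lambda>v. f v w) \<in> linear_maps K V U"
  shows "f \<in> bilinear_maps K V W U"
  using assms unfolding bilinear_maps_def by auto

lemma bilinear_mapsD:
  assumes "f \<in> bilinear_maps K V W U"
  shows "v \<in> carrier V \<Longrightarrow> f v \<in> linear_maps K W U"
    and "w \<in> carrier W \<Longrightarrow> (\<lambda>v. f v w) \<in> linear_maps K V U"
  using assms unfolding bilinear_maps_def by auto

lemma bilinear_mapsD':
  assumes "f \<in> bilinear_maps K V W U"
  shows "\<lbrakk>v \<in> carrier V; w \<in> carrier W\<rbrakk> \<Longrightarrow> f v w \<in> carrier U"
    and "\<lbrakk>v \<in> carrier V; w \<in> carrier W; w' \<in> carrier W\<rbrakk> \<Longrightarrow>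
      f v (w \<oplus>\<^bsub>W\<^esub> w') = f v w \<oplus>\<^bsub>U\<^esub> f v w'"
    and "\<lbrakk>v \<in> carrier V; v' \<in> carrier V; w \<in> carrier W\<rbrakk> \<Longrightarrow>
      f (v \<oplus>\<^bsub>V\<^esub> v') w = f v w \<oplus>\<^bsub>U\<^esub> f v' w"
    and "\<lbrakk>a \<in> carrier K; v \<in> carrier V; w \<in> carrier W\<rbrakk> \<Longrightarrow>
      f v (a \<odot>\<^bsub>W\<^esub> w) = a \<odot>\<^bsub>U\<^esub> f v w"
    and "\<lbrakk>a \<in> carrier K; v \<in> carrier V; w \<in> carrier W\<rbrakk> \<Longrightarrow>
      f (a \<odot>\<^bsub>V\<^esub> v) w = a \<odot>\<^bsub>U\<^esub> f v w"
proof -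
  note D = bilinear_mapsD[OF assms]
  note L = linear_mapsD[OF D(1)] and R = linear_mapsD[OF D(2)]
  show "\<lbrakk>v \<in> carrier V; w \<in> carrier W\<rbrakk> \<Longrightarrow> f v w \<in> carrier U"
    by (rule L(1))
  show "\<lbrakk>v \<in> carrier V; w \<in> carrier W; w' \<in> carrier W\<rbrakk> \<Longrightarrow>
      f v (w \<oplus>\<^bsub>W\<^esub> w') = f v w \<oplus>\<^bsub>U\<^esub> f v w'"
    by (rule L(2))
  show "\<lbrakk>v \<in> carrier V; v' \<in> carrier V; w \<in> carrier W\<rbrakk> \<Longrightarrow>
      f (v \<oplus>\<^bsub>V\<^esub> v') w = f v w \<oplus>\<^bsub>U\<^esub> f v' w"
    by (rule R(2))
  show "\<lbrakk>a \<in> carrier K; v \<in> carrier V; w \<in> carrier W\<rbrakk> \<Longrightarrow>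
      f v (a \<odot>\<^bsub>W\<^esub> w) = a \<odot>\<^bsub>U\<^esub> f v w"
    by (rule L(3))
  show "\<lbrakk>a \<in> carrier K; v \<in> carrier V; w \<in> carrier W\<rbrakk> \<Longrightarrow>
      f (a \<odot>\<^bsub>V\<^esub> v) w = a \<odot>\<^bsub>U\<^esub> f v w"
    by (rule R(3))
qed

section \<open>Free modules and quotient modules\<close>

lemma (in cring) free_module_module: "module R (free_module R X)"
proof -
  let ?F = "free_module R X"
  have add: "f \<oplus>\<^bsub>?F\<^esub> g \<in> carrier ?F" if "f \<in> carrier ?F" "g \<in> carrier ?F" for f g
  proof -
    have "{x. f x \<oplus> g x \<noteq> \<zero>} \<subseteq> {x. f x \<noteq> \<zero>} \<union> {x. g x \<noteq> \<zero>}" by auto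
    then have "finite {x. f x \<oplus> g x \<noteq> \<zero>}"
      by (rule finite_subset) (use that in \<open>auto simp: free_module_def\<close>)
    then show ?thesis using that by (auto simp: free_module_def)
  qed
  have smult: "a \<odot>\<^bsub>?F\<^esub> g \<in> carrier ?F" if "a \<in> carrier R" "g \<in> carrier ?F" for a g
  proof -
    have "{x. a \<otimes> g x \<noteq> \<zero>} \<subseteq> {x. g x \<noteq> \<zero>}" using that by auto
    then have "finite {x. a \<otimes> g x \<noteq> \<zero>}"
      by (rule finite_subset) (use that in \<open>auto simp: free_module_def\<close>)
    then show ?thesis using that by (auto simp: free_module_def)
  qed
  have closed: "f x \<in> carrier R" if "f \<in> carrier ?F" for f x
    using that by (cases "x \<in> X") (auto simp: free_module_def)
  show ?thesis
  proof (rule moduleI)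
    show "cring R" by (rule is_cring)
    show "abelian_group ?F"
    proof (rule abelian_groupI)
      fix f assume f: "f \<in> carrier ?F"
      \<comment> \<open>The additive inverse is taken to be the multiple by
        \<open>\<ominus> \<one>\<close>, so that its membership in the carrier is an instance of
        \<open>smult\<close>.\<close>
      have "(\<ominus> \<one>) \<odot>\<^bsub>?F\<^esub> f \<oplus>\<^bsub>?F\<^esub> f = \<zero>\<^bsub>?F\<^esub>"
        using closed[OF f] by (auto simp: free_module_def fun_eq_iff l_minus l_neg)
      then show "\<exists>g\<in>carrier ?F. g \<oplus>\<^bsub>?F\<^esub> f = \<zero>\<^bsub>?F\<^esub>"
        using smult[of "\<ominus> \<one>" f] f by auto
    next
      show "\<zero>\<^bsub>?F\<^esub> \<in> carrier ?F" by (simp add: free_module_def)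
    next
      fix f assume "f \<in> carrier ?F"
      with closed[OF this] show "\<zero>\<^bsub>?F\<^esub> \<oplus>\<^bsub>?F\<^esub> f = f"
        by (simp add: free_module_def)
    next
      fix f g assume "f \<in> carrier ?F" "g \<in> carrier ?F"
      with closed show "f \<oplus>\<^bsub>?F\<^esub> g = g \<oplus>\<^bsub>?F\<^esub> f"
        by (auto simp: free_module_def fun_eq_iff a_comm)
    next
      fix f g h assume "f \<in> carrier ?F" "g \<in> carrier ?F" "h \<in> carrier ?F"
      with closed show "f \<oplus>\<^bsub>?F\<^esub> g \<oplus>\<^bsub>?F\<^esub> h = f \<oplus>\<^bsub>?F\<^esub> (g \<oplus>\<^bsub>?F\<^esub> h)"
        by (auto simp: free_module_def fun_eq_iff a_assoc)
    qed (rule add)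
  next
    fix a b f assume "a \<in> carrier R" "b \<in> carrier R" "f \<in> carrier ?F"
    with closed[of f] show "(a \<oplus> b) \<odot>\<^bsub>?F\<^esub> f = a \<odot>\<^bsub>?F\<^esub> f \<oplus>\<^bsub>?F\<^esub> b \<odot>\<^bsub>?F\<^esub> f"
      and "(a \<otimes> b) \<odot>\<^bsub>?F\<^esub> f = a \<odot>\<^bsub>?F\<^esub> (b \<odot>\<^bsub>?F\<^esub> f)"
      by (simp_all add: free_module_def fun_eq_iff l_distr m_assoc)
  next
    fix a f g assume "a \<in> carrier R" "f \<in> carrier ?F" "g \<in> carrier ?F"
    with closed[of f] closed[of g]
    show "a \<odot>\<^bsub>?F\<^esub> (f \<oplus>\<^bsub>?F\<^esub> g) = a \<odot>\<^bsub>?F\<^esub> f \<oplus>\<^bsub>?F\<^esub> a \<odot>\<^bsub>?F\<^esub> g"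
      by (simp add: free_module_def fun_eq_iff r_distr)
  next
    fix f assume "f \<in> carrier ?F"
    with closed[of f] show "\<one> \<odot>\<^bsub>?F\<^esub> f = f"
      by (simp add: free_module_def fun_eq_iff)
  qed (rule smult)
qed

lemma (in cring) free_module_carrierD:
  assumes "f \<in> carrier (free_module R X)"
  shows "f x \<in> carrier R" and "x \<notin> X \<Longrightarrow> f x = \<zero>" and "finite {x. f x \<noteq> \<zero>}"
proof -
  show "f x \<in> carrier R"
    using assms by (cases "x \<in> X") (auto simp: free_module_def)
qed (use assms in \<open>auto simp: free_module_def\<close>)

lemma (in cring) free_gen_closed: "x \<in> X \<Longrightarrow> free_gen R x \<in> carrier (free_module R X)"
  by (auto simp: free_module_def free_gen_def)

text \<open>A function of finite support is a finite combination of generators. The inner induction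
  runs over any finite set containing the support, and each step removes one coefficient.\<close>

lemma (in cring) free_module_induct [consumes 1, case_names zero add smult gen]:
  assumes f: "f \<in> carrier (free_module R X)"
    and zero: "P (\<zero>\<^bsub>free_module R X\<^esub>)"
    and add: "\<And>f g. \<lbrakk>f \<in> carrier (free_module R X); g \<in> carrier (free_module R X); P f; P g\<rbrakk>
      \<Longrightarrow> P (f \<oplus>\<^bsub>free_module R X\<^esub> g)"
    and smult: "\<And>a f. \<lbrakk>a \<in> carrier R; f \<in> carrier (free_module R X); P f\<rbrakk>
      \<Longrightarrow> P (a \<odot>\<^bsub>free_module R X\<^esub> f)"
    and gen: "\<And>x. x \<in> X \<Longrightarrow> P (free_gen R x)"
  shows "P f"
proof -
  let ?F = "free_module R X"
  interpret F: module R ?F by (rule free_module_module)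
  have "finite A \<Longrightarrow> f \<in> carrier ?F \<Longrightarrow> {x. f x \<noteq> \<zero>} \<subseteq> A \<Longrightarrow> P f" for A f
  proof (induction A arbitrary: f rule: finite_induct)
    case empty
    then have "f = \<zero>\<^bsub>?F\<^esub>" by (auto simp: free_module_def)
    then show ?case using zero by simp
  next
    case (insert x A)
    show ?case
    proof (cases "x \<in> X")
      case True
      define g where "g = f(x := \<zero>)"
      have fin: "finite {y. g y \<noteq> \<zero>}"
        by (rule finite_subset[OF _ free_module_carrierD(3)[OF insert.prems(1)]])
          (auto simp: g_def)
      have g: "g \<in> carrier ?F"
        using insert.prems(1) fin by (auto simp: free_module_def g_def)
      have "P g"
        by (rule insert.IH[OF g]) (use insert.prems in \<open>auto simp: g_def\<close>)
      moreover have "f x \<odot>\<^bsub>?F\<^esub> free_gen R x \<oplus>\<^bsub>?F\<^esub> g = f"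
        using free_module_carrierD(1)[OF insert.prems(1)]
        by (auto simp: free_module_def free_gen_def g_def fun_eq_iff)
      moreover have "P (f x \<odot>\<^bsub>?F\<^esub> free_gen R x)"
        by (intro smult gen free_gen_closed free_module_carrierD(1)[OF insert.prems(1)] True)
      moreover have "f x \<odot>\<^bsub>?F\<^esub> free_gen R x \<in> carrier ?F"
        by (intro F.smult_closed free_gen_closed free_module_carrierD(1)[OF insert.prems(1)] True)
      ultimately show ?thesis
        using add[of "f x \<odot>\<^bsub>?F\<^esub> free_gen R x" g] g by (simp only:)
    next
      case False
      then have "f x = \<zero>" by (rule free_module_carrierD(2)[OF insert.prems(1)])
      then show ?thesis using insert.IH[OF insert.prems(1)] insert.prems(2) by blast
    qed
  qed
  then show ?thesis using f free_module_carrierD(3)[OF f] by blast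
qed

lemma quotient_carrier: "carrier (quotient_module K F N) = (\<lambda>x. N +>\<^bsub>F\<^esub> x) ` carrier F"
  by (auto simp: quotient_module_def A_RCOSETS_def RCOSETS_def a_r_coset_def)

text \<open>Fixes the record type to the plain \<open>module\<close> type, which is the one that
  \<open>quotient_module\<close> and \<open>tensor\<close> accept.\<close>

locale plain_module = module K F
  for K :: "('k, 'z) ring_scheme" (structure) and F :: "('k, 'v) module"
begin

lemma abelian_subgroup_submodule:
  assumes "submodule N K F"
  shows "abelian_subgroup N F"
  using assms a_comm_group by (intro abelian_subgroupI2) (auto dest: submodule.axioms(1))

text \<open>Scalar multiplication of a coset is defined as a union over all representatives. Each
  representative contributes the same coset, since a submodule is stable under scalars.\<close>

lemma quotient_smult:
  assumes N: "submodule N K F" and a: "a \<in> carrier K" and x: "x \<in> carrier F"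
  shows "a \<odot>\<^bsub>quotient_module K F N\<^esub> (N +>\<^bsub>F\<^esub> x) = N +>\<^bsub>F\<^esub> (a \<odot>\<^bsub>F\<^esub> x)"
proof -
  interpret N: abelian_subgroup N F by (rule abelian_subgroup_submodule[OF N])
  interpret N: submodule N K F by (rule N)
  have "N +>\<^bsub>F\<^esub> (a \<odot>\<^bsub>F\<^esub> y) = N +>\<^bsub>F\<^esub> (a \<odot>\<^bsub>F\<^esub> x)" if y: "y \<in> N +>\<^bsub>F\<^esub> x" for y
  proof -
    obtain n where n: "n \<in> N" "y = n \<oplus>\<^bsub>F\<^esub> x" using y by (auto simp: a_r_coset_def')
    then have "a \<odot>\<^bsub>F\<^esub> y = a \<odot>\<^bsub>F\<^esub> n \<oplus>\<^bsub>F\<^esub> a \<odot>\<^bsub>F\<^esub> x"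
      using a x N.a_subset by (auto intro!: smult_r_distr)
    then have "a \<odot>\<^bsub>F\<^esub> y \<in> N +>\<^bsub>F\<^esub> (a \<odot>\<^bsub>F\<^esub> x)"
      using n a by (auto simp: a_r_coset_def')
    then show ?thesis
      using M.a_repr_independence[OF _ smult_closed[OF a x] N.a_subgroup] by simp
  qed
  \<comment> \<open>Without a representative the union would be empty instead of the common
    coset.\<close>
  moreover have "N +>\<^bsub>F\<^esub> x \<noteq> {}" using N.a_rcos_self[OF x] by blast
  ultimately have "(\<Union>y\<in>N +>\<^bsub>F\<^esub> x. N +>\<^bsub>F\<^esub> (a \<odot>\<^bsub>F\<^esub> y)) = N +>\<^bsub>F\<^esub> (a \<odot>\<^bsub>F\<^esub> x)"
    by (intro SUP_eq_const)
  then show ?thesis by (simp add: quotient_module_def)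
qed

lemma quotient_add:
  assumes N: "submodule N K F" and "x \<in> carrier F" "y \<in> carrier F"
  shows "(N +>\<^bsub>F\<^esub> x) \<oplus>\<^bsub>quotient_module K F N\<^esub> (N +>\<^bsub>F\<^esub> y) = N +>\<^bsub>F\<^esub> (x \<oplus>\<^bsub>F\<^esub> y)"
  using abelian_subgroup.a_rcos_sum[OF abelian_subgroup_submodule[OF N]] assms(2,3)
  by (simp add: quotient_module_def)

lemma quotient_zero:
  assumes "submodule N K F"
  shows "\<zero>\<^bsub>quotient_module K F N\<^esub> = N +>\<^bsub>F\<^esub> \<zero>\<^bsub>F\<^esub>"
proof -
  have "N +>\<^bsub>F\<^esub> \<zero>\<^bsub>F\<^esub> = N"
    by (rule M.a_coset_add_zero) (rule submoduleE(1)[OF assms])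
  then show ?thesis by (simp add: quotient_module_def)
qed

lemma quotient_module_module:
  assumes N: "submodule N K F"
  shows "module K (quotient_module K F N)"
proof (rule moduleI)
  show "abelian_group (quotient_module K F N)"
  proof (rule abelian_groupI)
    fix X assume "X \<in> carrier (quotient_module K F N)"
    then obtain x where "x \<in> carrier F" "X = N +>\<^bsub>F\<^esub> x" by (auto simp: quotient_carrier)
    then show "\<exists>Y\<in>carrier (quotient_module K F N).
        Y \<oplus>\<^bsub>quotient_module K F N\<^esub> X = \<zero>\<^bsub>quotient_module K F N\<^esub>"
      by (intro bexI[of _ "N +>\<^bsub>F\<^esub> (\<ominus>\<^bsub>F\<^esub> x)"])
        (auto simp: quotient_carrier quotient_add[OF N] quotient_zero[OF N] M.l_neg)
  qed (auto simp: quotient_carrier quotient_add[OF N] quotient_zero[OF N] M.a_ac)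
qed (auto simp: quotient_carrier quotient_add[OF N] quotient_smult[OF N] smult_assoc1
      smult_l_distr smult_r_distr R.is_cring)

end

section \<open>The tensor product\<close>

text \<open>A derivation in \<open>foldSetD\<close> over \<open>A\<close> evaluates the summand only
  at points of \<open>A\<close>, so agreement there forces equal sums, even for values outside the
  carrier. Hence \<open>tensor_lift_cong\<close> applies before anything is known about closure of
  the integrands.\<close>

lemma finsum_cong_simple:
  assumes "\<And>x. x \<in> A \<Longrightarrow> f x = g x"
  shows "finsum G f A = finsum G g A"
proof -
  let ?F = "\<lambda>h. foldSetD (carrier G) (\<lambda>x. (\<oplus>\<^bsub>G\<^esub>) (h x)) \<zero>\<^bsub>G\<^esub>"
  have *: "(B, y) \<in> ?F h" if "(B, y) \<in> ?F h'" "\<forall>x\<in>B. h x = h' x" for B y h h'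
    using that
  proof induction
    case (insertI x A y)
    then have "(insert x A, h x \<oplus>\<^bsub>G\<^esub> y) \<in> ?F h"
      by (intro foldSetD.insertI) auto
    then show ?case using insertI by simp
  qed (rule foldSetD.emptyI)
  have "(A, y) \<in> ?F f \<longleftrightarrow> (A, y) \<in> ?F g" for y
    using *[of A y f g] *[of A y g f] assms by auto
  then show ?thesis by (simp add: finsum_def finprod_def foldD_def o_def)
qed

text \<open>Both sides choose the same representative of the tensor. The premises on the modules and
  on \<open>t\<close> absorb index equations such as \<open>p \<otimes> \<one> = p\<close>.\<close>

lemma tensor_lift_cong:
  assumes "V = V'" "W = W'" "U = U'" "t = t'"
    and "\<And>v w. \<lbrakk>v \<in> carrier V'; w \<in> carrier W'\<rbrakk> \<Longrightarrow> f v w = g v w"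
  shows "tensor_lift K V W U f t = tensor_lift K V' W' U' g t'"
  unfolding tensor_lift_def Let_def assms(1-4)
  by (rule finsum_cong_simple) (auto simp: assms)

section \<open>Linear extension from generators\<close>

text \<open>For pairs as generators this is the sum inside \<open>tensor_lift\<close>, but as a
  function of the representative, where linearity can be stated before passing to cosets.\<close>

definition free_eval ::
  "('k, 'z) ring_scheme \<Rightarrow> 'x set \<Rightarrow> ('k, 'u, 'y) module_scheme \<Rightarrow> ('x \<Rightarrow> 'u) \<Rightarrow> ('x \<Rightarrow> 'k) \<Rightarrow> 'u" where
  "free_eval K X U f x = (\<Oplus>\<^bsub>U\<^esub>p\<in>{p \<in> X. x p \<noteq> \<zero>\<^bsub>K\<^esub>}. x p \<odot>\<^bsub>U\<^esub> f p)"

text \<open>Terms outside the support vanish. The point is to compare \<open>x\<close>,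
  \<open>y\<close> and their sum, whose supports differ, over one common index set.\<close>

lemma (in plain_module) free_eval_superset:
  assumes x: "x \<in> carrier (free_module K X)" and f: "f \<in> X \<rightarrow> carrier F"
    and A: "finite A" "{p. x p \<noteq> \<zero>} \<subseteq> A" "A \<subseteq> X"
  shows "free_eval K X F f x = (\<Oplus>\<^bsub>F\<^esub>p\<in>A. x p \<odot>\<^bsub>F\<^esub> f p)"
  unfolding free_eval_def
  by (rule M.add.finprod_mono_neutral_cong_left)
    (use A f R.free_module_carrierD[OF x] in \<open>auto simp: Pi_iff\<close>)

lemma (in plain_module) free_eval_linear:
  assumes f: "f \<in> X \<rightarrow> carrier F"
  shows "free_eval K X F f \<in> linear_maps K (free_module K X) F"
proof -
  let ?F = "free_module K X"
  interpret F: module K ?F by (rule R.free_module_module)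
  note D = R.free_module_carrierD
  have supp: "{p. x p \<noteq> \<zero>} \<subseteq> X" if "x \<in> carrier ?F" for x
    using D(2)[OF that] by blast
  show ?thesis
  proof (rule linear_mapsI)
    fix x assume x: "x \<in> carrier ?F"
    show "free_eval K X F f x \<in> carrier F"
      unfolding free_eval_def using f D[OF x] by (auto intro!: M.finsum_closed)
  next
    fix x y assume xy: "x \<in> carrier ?F" "y \<in> carrier ?F"
    let ?A = "{p. x p \<noteq> \<zero>} \<union> {p. y p \<noteq> \<zero>}"
    have A: "finite ?A" "?A \<subseteq> X" using D(3) supp xy by auto
    have sub: "{p. (x \<oplus>\<^bsub>?F\<^esub> y) p \<noteq> \<zero>} \<subseteq> ?A" by (auto simp: free_module_def)
    have "free_eval K X F f (x \<oplus>\<^bsub>?F\<^esub> y) = (\<Oplus>\<^bsub>F\<^esub>p\<in>?A. (x \<oplus>\<^bsub>?F\<^esub> y) p \<odot>\<^bsub>F\<^esub> f p)"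
      by (rule free_eval_superset[OF F.a_closed[OF xy] f A(1) sub A(2)])
    also have "\<dots> = (\<Oplus>\<^bsub>F\<^esub>p\<in>?A. x p \<odot>\<^bsub>F\<^esub> f p \<oplus>\<^bsub>F\<^esub> y p \<odot>\<^bsub>F\<^esub> f p)"
      by (rule finsum_cong_simple)
        (use f A(2) D(1) xy in \<open>auto simp: free_module_def intro!: smult_l_distr\<close>)
    also have "\<dots> = (\<Oplus>\<^bsub>F\<^esub>p\<in>?A. x p \<odot>\<^bsub>F\<^esub> f p) \<oplus>\<^bsub>F\<^esub> (\<Oplus>\<^bsub>F\<^esub>p\<in>?A. y p \<odot>\<^bsub>F\<^esub> f p)"
      by (rule M.finsum_addf) (use A(2) D(1)[OF xy(1)] D(1)[OF xy(2)] in \<open>auto intro!: smult_closed funcset_mem[OF f]\<close>)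
    also have "\<dots> = free_eval K X F f x \<oplus>\<^bsub>F\<^esub> free_eval K X F f y"
      using free_eval_superset[OF xy(1) f A(1) _ A(2)] free_eval_superset[OF xy(2) f A(1) _ A(2)]
      by simp
    finally show "free_eval K X F f (x \<oplus>\<^bsub>?F\<^esub> y) = free_eval K X F f x \<oplus>\<^bsub>F\<^esub> free_eval K X F f y" .
  next
    fix a x assume a: "a \<in> carrier K" and x: "x \<in> carrier ?F"
    let ?A = "{p. x p \<noteq> \<zero>}"
    have A: "finite ?A" "?A \<subseteq> X" using D(3) supp x by auto
    have sub: "{p. (a \<odot>\<^bsub>?F\<^esub> x) p \<noteq> \<zero>} \<subseteq> ?A" using a by (auto simp: free_module_def)
    have "free_eval K X F f (a \<odot>\<^bsub>?F\<^esub> x) = (\<Oplus>\<^bsub>F\<^esub>p\<in>?A. (a \<odot>\<^bsub>?F\<^esub> x) p \<odot>\<^bsub>F\<^esub> f p)"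
      by (rule free_eval_superset[OF F.smult_closed[OF a x] f A(1) sub A(2)])
    also have "\<dots> = (\<Oplus>\<^bsub>F\<^esub>p\<in>?A. a \<odot>\<^bsub>F\<^esub> (x p \<odot>\<^bsub>F\<^esub> f p))"
      by (rule finsum_cong_simple)
        (use f A(2) D(1)[OF x] a in \<open>auto simp: free_module_def intro!: smult_assoc1\<close>)
    also have "\<dots> = a \<odot>\<^bsub>F\<^esub> (\<Oplus>\<^bsub>F\<^esub>p\<in>?A. x p \<odot>\<^bsub>F\<^esub> f p)"
      by (rule finsum_smult_ldistr[symmetric]) (use f A D(1)[OF x] a in auto)
    also have "\<dots> = a \<odot>\<^bsub>F\<^esub> free_eval K X F f x"
      using free_eval_superset[OF x f A(1) _ A(2)] by simp
    finally show "free_eval K X F f (a \<odot>\<^bsub>?F\<^esub> x) = a \<odot>\<^bsub>F\<^esub> free_eval K X F f x" .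
  qed
qed

lemma (in plain_module) free_eval_gen:
  assumes f: "f \<in> X \<rightarrow> carrier F" and p: "p \<in> X"
  shows "free_eval K X F f (free_gen K p) = f p"
proof -
  have "free_eval K X F f (free_gen K p) = (\<Oplus>\<^bsub>F\<^esub>q\<in>{p}. free_gen K p q \<odot>\<^bsub>F\<^esub> f q)"
    by (rule free_eval_superset[OF R.free_gen_closed f]) (use p in \<open>auto simp: free_gen_def\<close>)
  also have "\<dots> = f p"
    using M.finsum_insert[of "{}" p "\<lambda>q. free_gen K p q \<odot>\<^bsub>F\<^esub> f q"] funcset_mem[OF f p]
    by (simp add: free_gen_def)
  finally show ?thesis .
qed

lemma linear_maps_zero:
  assumes "module K V" "module K W" "f \<in> linear_maps K V W"
  shows "f \<zero>\<^bsub>V\<^esub> = \<zero>\<^bsub>W\<^esub>"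
proof -
  interpret V: module K V by fact
  interpret W: module K W by fact
  have "f \<zero>\<^bsub>V\<^esub> = f (\<zero>\<^bsub>K\<^esub> \<odot>\<^bsub>V\<^esub> \<zero>\<^bsub>V\<^esub>)" by simp
  then show ?thesis using linear_mapsD(3)[OF assms(3)] linear_mapsD(1)[OF assms(3)]
    by (metis V.M.zero_closed V.R.zero_closed W.smult_l_null)
qed

lemma linear_maps_minus:
  assumes "module K V" "module K W" "f \<in> linear_maps K V W" "x \<in> carrier V" "y \<in> carrier V"
  shows "f (x \<ominus>\<^bsub>V\<^esub> y) = f x \<ominus>\<^bsub>W\<^esub> f y"
proof -
  interpret V: module K V by fact
  interpret W: module K W by fact
  note D = linear_mapsD[OF assms(3)]
  \<comment> \<open>\<open>linear_maps\<close> speaks of sums and scalars only, so the difference is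
    rewritten with the scalar \<open>\<ominus> \<one>\<close>.\<close>
  have "x \<ominus>\<^bsub>V\<^esub> y = x \<oplus>\<^bsub>V\<^esub> (\<ominus>\<^bsub>K\<^esub> \<one>\<^bsub>K\<^esub>) \<odot>\<^bsub>V\<^esub> y"
    using assms(4,5) by (simp add: V.smult_l_minus a_minus_def)
  then show ?thesis using assms(4,5) D
    by (simp add: W.smult_l_minus a_minus_def)
qed

lemma submodule_Inter:
  assumes "module K M" "\<And>N. N \<in> A \<Longrightarrow> submodule N K M" "A \<noteq> {}"
  shows "submodule (\<Inter>A) K M"
proof -
  interpret M: module K M by fact
  note E = M.submoduleE[OF assms(2)]
  have "\<zero>\<^bsub>M\<^esub> \<in> N" if "N \<in> A" for N
    using subgroup.one_closed[OF submodule.axioms(1)[OF assms(2)[OF that]]] by simp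
  with assms(3) E show ?thesis
    by (intro M.submoduleI subsetI InterI; fastforce)
qed

section \<open>Construction and universal property of the tensor product\<close>

locale module_pair = V: module K V + W: module K W
  for K :: "('k, 'z) ring_scheme" and V :: "('k, 'v) module" and W :: "('k, 'w) module"
begin

abbreviation "pairs \<equiv> carrier V \<times> carrier W"
abbreviation "free_pairs \<equiv> free_module K pairs"
abbreviation "null \<equiv> tensor_null K V W"

sublocale F: plain_module K free_pairs
  by (rule plain_module.intro) (rule V.R.free_module_module)

lemma gen_closed: "\<lbrakk>v \<in> carrier V; w \<in> carrier W\<rbrakk> \<Longrightarrow> free_gen K (v, w) \<in> carrier free_pairs"
  by (rule V.R.free_gen_closed) auto

lemma tensor_relations_subset: "tensor_relations K V W \<subseteq> carrier free_pairs"
  unfolding tensor_relations_def Let_def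
  by (auto intro!: F.M.minus_closed F.M.a_closed gen_closed F.smult_closed)

text \<open>The hull is an intersection of submodules; the whole free module is one that contains
  the relations, so the family is nonempty.\<close>

lemma tensor_null_submodule: "submodule null K free_pairs"
  unfolding tensor_null_def hull_def
  by (rule submodule_Inter[OF F.module_axioms])
    (use tensor_relations_subset F.carrier_is_submodule in auto)

sublocale N: abelian_subgroup null free_pairs
  by (rule F.abelian_subgroup_submodule[OF tensor_null_submodule])

lemma tensor_module: "module K (tensor K V W)"
  unfolding tensor_def by (rule F.quotient_module_module[OF tensor_null_submodule])

lemma tensor_null_rel: "r \<in> tensor_relations K V W \<Longrightarrow> r \<in> null"
  unfolding tensor_null_def by (rule hull_inc)

lemma coset_eqI:
  assumes "x \<in> carrier free_pairs" "y \<in> carrier free_pairs" "x \<ominus>\<^bsub>free_pairs\<^esub> y \<in> null"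
  shows "null +>\<^bsub>free_pairs\<^esub> x = null +>\<^bsub>free_pairs\<^esub> y"
proof -
  have "x = (x \<ominus>\<^bsub>free_pairs\<^esub> y) \<oplus>\<^bsub>free_pairs\<^esub> y"
    using assms(1,2) by (simp add: a_minus_def F.M.a_assoc F.M.l_neg)
  then have "x \<in> null +>\<^bsub>free_pairs\<^esub> y" using assms(3) by (auto simp: a_r_coset_def')
  then show ?thesis using F.M.a_repr_independence[OF _ assms(2) N.a_subgroup] by simp
qed

text \<open>Each of the four laws is an equality of cosets whose representatives differ by a member
  of one of the four families in \<open>tensor_relations\<close>.\<close>

lemma pure_bilinear: "pure K V W \<in> bilinear_maps K V W (tensor K V W)"
proof -
  let ?T = "tensor K V W"
  have closed: "pure K V W v w \<in> carrier ?T" if "v \<in> carrier V" "w \<in> carrier W" for v w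
    unfolding pure_def tensor_def quotient_carrier using gen_closed[OF that] by blast
  note qa = F.quotient_add[OF tensor_null_submodule, folded tensor_def]
  note qs = F.quotient_smult[OF tensor_null_submodule, folded tensor_def]
  have 1: "pure K V W (v \<oplus>\<^bsub>V\<^esub> v') w = pure K V W v w \<oplus>\<^bsub>?T\<^esub> pure K V W v' w"
    if "v \<in> carrier V" "v' \<in> carrier V" "w \<in> carrier W" for v v' w
    unfolding pure_def using that
    by (simp add: qa gen_closed, intro coset_eqI tensor_null_rel F.M.a_closed gen_closed)
      (auto simp: tensor_relations_def Let_def)
  have 2: "pure K V W v (w \<oplus>\<^bsub>W\<^esub> w') = pure K V W v w \<oplus>\<^bsub>?T\<^esub> pure K V W v w'"
    if "v \<in> carrier V" "w \<in> carrier W" "w' \<in> carrier W" for v w w'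
    unfolding pure_def using that
    by (simp add: qa gen_closed, intro coset_eqI tensor_null_rel F.M.a_closed gen_closed)
      (auto simp: tensor_relations_def Let_def)
  have 3: "pure K V W (a \<odot>\<^bsub>V\<^esub> v) w = a \<odot>\<^bsub>?T\<^esub> pure K V W v w"
    if "a \<in> carrier K" "v \<in> carrier V" "w \<in> carrier W" for a v w
    unfolding pure_def using that
    by (simp add: qs gen_closed, intro coset_eqI tensor_null_rel F.smult_closed gen_closed)
      (auto simp: tensor_relations_def Let_def)
  have 4: "pure K V W v (a \<odot>\<^bsub>W\<^esub> w) = a \<odot>\<^bsub>?T\<^esub> pure K V W v w"
    if "a \<in> carrier K" "v \<in> carrier V" "w \<in> carrier W" for a v w
    unfolding pure_def using that
    by (simp add: qs gen_closed, intro coset_eqI tensor_null_rel F.smult_closed gen_closed)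
      (auto simp: tensor_relations_def Let_def)
  show ?thesis
    by (auto intro!: bilinear_mapsI linear_mapsI simp: closed 1 2 3 4)
qed

text \<open>Sums of pure tensors exhaust the tensor product: a scalar is absorbed into the left
  factor, and zero is \<open>\<zero> \<otimes> \<zero>\<close>. This is why there are no cases for
  scalars and zero.\<close>

lemma tensor_induct [consumes 1, case_names pure add]:
  assumes t: "t \<in> carrier (tensor K V W)"
    and pure: "\<And>v w. \<lbrakk>v \<in> carrier V; w \<in> carrier W\<rbrakk> \<Longrightarrow> P (pure K V W v w)"
    and add: "\<And>s t. \<lbrakk>s \<in> carrier (tensor K V W); t \<in> carrier (tensor K V W); P s; P t\<rbrakk>
      \<Longrightarrow> P (s \<oplus>\<^bsub>tensor K V W\<^esub> t)"
  shows "P t"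
proof -
  let ?T = "tensor K V W"
  note qa = F.quotient_add[OF tensor_null_submodule, folded tensor_def]
  note qs = F.quotient_smult[OF tensor_null_submodule, folded tensor_def]
  interpret T: module K ?T by (rule tensor_module)
  have qc: "null +>\<^bsub>free_pairs\<^esub> x \<in> carrier ?T" if "x \<in> carrier free_pairs" for x
    using that by (auto simp: tensor_def quotient_carrier)
  have B: "pure K V W \<in> bilinear_maps K V W ?T" by (rule pure_bilinear)
  have P0: "P \<zero>\<^bsub>?T\<^esub>"
  proof -
    have "pure K V W \<zero>\<^bsub>V\<^esub> \<zero>\<^bsub>W\<^esub> = \<zero>\<^bsub>?T\<^esub>"
      by (rule linear_maps_zero[OF W.module_axioms tensor_module bilinear_mapsD(1)[OF B]]) simp
    then show ?thesis using pure[of "\<zero>\<^bsub>V\<^esub>" "\<zero>\<^bsub>W\<^esub>"] by simp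
  qed
  \<comment> \<open>The claim is strengthened to all multiples because \<open>P\<close> itself is
    not assumed stable under scalars; at the end \<open>a\<close> is set to
    \<open>\<one>\<close>.\<close>
  have *: "\<forall>a\<in>carrier K. P (a \<odot>\<^bsub>?T\<^esub> (null +>\<^bsub>free_pairs\<^esub> x))" if "x \<in> carrier free_pairs" for x
    using that
  proof (induction rule: V.R.free_module_induct)
    case zero
    have "null +>\<^bsub>free_pairs\<^esub> \<zero>\<^bsub>free_pairs\<^esub> = \<zero>\<^bsub>?T\<^esub>"
      using F.quotient_zero[OF tensor_null_submodule, folded tensor_def] by simp
    then show ?case using P0 by simp
  next
    case (add f g)
    then show ?case
      by (auto simp flip: qa simp: T.smult_r_distr qc intro!: assms(3))
  next
    case (smult b f)
    then show ?case
      by (auto simp flip: qs T.smult_assoc1 simp: qc)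
  next
    case (gen p)
    then obtain v w where p: "p = (v, w)" "v \<in> carrier V" "w \<in> carrier W" by auto
    then show ?case
      using pure[of _ w] by (auto simp flip: pure_def bilinear_mapsD'(5)[OF B])
  qed
  obtain x where "x \<in> carrier free_pairs" "t = null +>\<^bsub>free_pairs\<^esub> x"
    using t by (auto simp: tensor_def quotient_carrier)
  with *[of x] V.R.one_closed T.smult_one[OF t] show ?thesis by metis
qed

end

text \<open>The linear extension of a bilinear \<open>f\<close> kills every defining relation, hence
  the submodule they generate, and so takes the same value on all elements of a coset.\<close>

lemma tensor_lift_bilinear:
  assumes "module K V" "module K W" "module K U" and f: "f \<in> bilinear_maps K V W U"
  shows tensor_lift_linear: "tensor_lift K V W U f \<in> linear_maps K (tensor K V W) U"
    and tensor_lift_pure: "\<lbrakk>v \<in> carrier V; w \<in> carrier W\<rbrakk> \<Longrightarrow>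
      tensor_lift K V W U f (pure K V W v w) = f v w"
proof -
  interpret V: module K V by fact
  interpret W: module K W by fact
  interpret U: plain_module K U by (rule plain_module.intro) fact
  interpret module_pair K V W ..
  let ?T = "tensor K V W"
  let ?f = "\<lambda>p. f (fst p) (snd p)"
  let ?e = "free_eval K pairs U ?f"
  note fD = bilinear_mapsD'[OF f]
  have f': "?f \<in> pairs \<rightarrow> carrier U" using fD(1) by auto
  have lin: "?e \<in> linear_maps K free_pairs U" by (rule U.free_eval_linear[OF f'])
  note eD = linear_mapsD[OF lin]
  note eM = linear_maps_minus[OF F.module_axioms U.module_axioms lin]
  have gen: "?e (free_gen K (v, w)) = f v w" if "v \<in> carrier V" "w \<in> carrier W" for v w
    using U.free_eval_gen[OF f', of "(v, w)"] that by simp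
  have self: "x \<ominus>\<^bsub>U\<^esub> x = \<zero>\<^bsub>U\<^esub>" if "x \<in> carrier U" for x
    using that by (simp add: a_minus_def U.M.r_neg)
  have e0: "?e \<zero>\<^bsub>free_pairs\<^esub> = \<zero>\<^bsub>U\<^esub>"
    by (rule linear_maps_zero[OF F.module_axioms U.module_axioms lin])
  \<comment> \<open>Minimality of the hull is applied to this kernel, which requires it to be a
    submodule.\<close>
  have ker: "submodule {x \<in> carrier free_pairs. ?e x = \<zero>\<^bsub>U\<^esub>} K free_pairs"
  proof (rule F.submoduleI)
    fix a assume a: "a \<in> {x \<in> carrier free_pairs. ?e x = \<zero>\<^bsub>U\<^esub>}"
    then have "?e (\<zero>\<^bsub>free_pairs\<^esub> \<ominus>\<^bsub>free_pairs\<^esub> a) = \<zero>\<^bsub>U\<^esub>"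
      by (subst eM) (auto simp: e0 self)
    then show "\<ominus>\<^bsub>free_pairs\<^esub> a \<in> {x \<in> carrier free_pairs. ?e x = \<zero>\<^bsub>U\<^esub>}"
      using a by (auto simp: a_minus_def)
  qed (auto simp: e0 eD)
  have "tensor_relations K V W \<subseteq> {x \<in> carrier free_pairs. ?e x = \<zero>\<^bsub>U\<^esub>}"
  proof
    fix r assume r: "r \<in> tensor_relations K V W"
    then have "?e r = \<zero>\<^bsub>U\<^esub>"
      unfolding tensor_relations_def Let_def
      by (auto simp: eM eD gen gen_closed fD self F.M.a_closed F.smult_closed)
    then show "r \<in> {x \<in> carrier free_pairs. ?e x = \<zero>\<^bsub>U\<^esub>}"
      using r tensor_relations_subset by auto
  qed
  then have null: "null \<subseteq> {x \<in> carrier free_pairs. ?e x = \<zero>\<^bsub>U\<^esub>}"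
    unfolding tensor_null_def by (rule hull_minimal) (rule ker)
  \<comment> \<open>Whichever representative \<open>SOME\<close> picks, it differs from
    \<open>x\<close> by an element of \<open>null\<close>, where the extension vanishes.\<close>
  have val: "tensor_lift K V W U f (null +>\<^bsub>free_pairs\<^esub> x) = ?e x" if x: "x \<in> carrier free_pairs" for x
  proof -
    define y where "y = (SOME y. y \<in> null +>\<^bsub>free_pairs\<^esub> x)"
    have "y \<in> null +>\<^bsub>free_pairs\<^esub> x" unfolding y_def
      using someI[of "\<lambda>y. y \<in> null +>\<^bsub>free_pairs\<^esub> x" x] N.a_rcos_self[OF x] by blast
    then obtain n where n: "n \<in> null" "y = n \<oplus>\<^bsub>free_pairs\<^esub> x" by (auto simp: a_r_coset_def')
    then have "?e y = ?e x" using null x by (auto simp: eD)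
    then show ?thesis unfolding tensor_lift_def Let_def y_def free_eval_def .
  qed
  show "tensor_lift K V W U f \<in> linear_maps K ?T U"
    by (rule linear_mapsI)
      (auto simp: tensor_def quotient_carrier F.quotient_add[OF tensor_null_submodule]
        F.quotient_smult[OF tensor_null_submodule] val eD)
  show "tensor_lift K V W U f (pure K V W v w) = f v w" if "v \<in> carrier V" "w \<in> carrier W"
    unfolding pure_def using that by (simp add: val gen_closed gen)
qed

section \<open>Calculus of lifts\<close>

lemma tensor_module: "\<lbrakk>module K V; module K W\<rbrakk> \<Longrightarrow> module K (tensor K V W)"
  by (rule module_pair.tensor_module) (rule module_pair.intro)

lemma tensor_induct [consumes 3, case_names pure add]:
  assumes "module K V" "module K W" and "t \<in> carrier (tensor K V W)"
    and "\<And>v w. \<lbrakk>v \<in> carrier V; w \<in> carrier W\<rbrakk> \<Longrightarrow> P (pure K V W v w)"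
    and "\<And>s t. \<lbrakk>s \<in> carrier (tensor K V W); t \<in> carrier (tensor K V W); P s; P t\<rbrakk>
      \<Longrightarrow> P (s \<oplus>\<^bsub>tensor K V W\<^esub> t)"
  shows "P t"
  using module_pair.tensor_induct[OF module_pair.intro[OF assms(1,2)], of t P] assms(3-5) by blast

lemma pure_linear:
  assumes "module K V" "module K W"
  shows pure_linear_left: "\<lbrakk>f \<in> linear_maps K X V; w \<in> carrier W\<rbrakk> \<Longrightarrow>
      (\<lambda>x. pure K V W (f x) w) \<in> linear_maps K X (tensor K V W)"
    and pure_linear_right: "\<lbrakk>g \<in> linear_maps K X W; v \<in> carrier V\<rbrakk> \<Longrightarrow>
      (\<lambda>x. pure K V W v (g x)) \<in> linear_maps K X (tensor K V W)"
    and pure_closed: "\<lbrakk>v \<in> carrier V; w \<in> carrier W\<rbrakk> \<Longrightarrow>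
      pure K V W v w \<in> carrier (tensor K V W)"
proof -
  note B = module_pair.pure_bilinear[OF module_pair.intro[OF assms]]
  show "\<lbrakk>f \<in> linear_maps K X V; w \<in> carrier W\<rbrakk> \<Longrightarrow>
      (\<lambda>x. pure K V W (f x) w) \<in> linear_maps K X (tensor K V W)"
    by (rule linear_maps_comp[OF bilinear_mapsD(2)[OF B]])
  show "\<lbrakk>g \<in> linear_maps K X W; v \<in> carrier V\<rbrakk> \<Longrightarrow>
      (\<lambda>x. pure K V W v (g x)) \<in> linear_maps K X (tensor K V W)"
    by (rule linear_maps_comp[OF bilinear_mapsD(1)[OF B]])
  show "\<lbrakk>v \<in> carrier V; w \<in> carrier W\<rbrakk> \<Longrightarrow>
      pure K V W v w \<in> carrier (tensor K V W)"
    by (rule bilinear_mapsD'(1)[OF B])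
qed

lemma tensor_lift_linear_arg:
  assumes "module K V" "module K W" "module K U" "f \<in> bilinear_maps K V W U"
    and "g \<in> linear_maps K X (tensor K V W)"
  shows "(\<lambda>x. tensor_lift K V W U f (g x)) \<in> linear_maps K X U"
  by (rule linear_maps_comp[OF tensor_lift_linear]) (use assms in auto)

lemma tensor_lift_closed:
  assumes "module K V" "module K W" "module K U" "f \<in> bilinear_maps K V W U"
    and "t \<in> carrier (tensor K V W)"
  shows "tensor_lift K V W U f t \<in> carrier U"
  by (rule linear_mapsD(1)[OF tensor_lift_linear]) (use assms in auto)

lemma linear_maps_eqI:
  assumes "module K V" "module K W" "f \<in> linear_maps K (tensor K V W) U"
    "g \<in> linear_maps K (tensor K V W) U"
    and "\<And>v w. \<lbrakk>v \<in> carrier V; w \<in> carrier W\<rbrakk> \<Longrightarrow> f (pure K V W v w) = g (pure K V W v w)"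
    and "t \<in> carrier (tensor K V W)"
  shows "f t = g t"
  using assms(1,2,6)
  by (induction rule: tensor_induct)
    (simp_all add: assms(5) linear_mapsD(2)[OF assms(3)] linear_mapsD(2)[OF assms(4)])

text \<open>Both sides are linear in \<open>t\<close> and agree on pure tensors. This is the rule
  that moves a linear map under a Sweedler sum, or out of it when used in reverse.\<close>

lemma tensor_lift_comp:
  assumes "module K V" "module K W" "module K U" "module K U'"
    and "f \<in> bilinear_maps K V W U" "g \<in> linear_maps K U U'" "t \<in> carrier (tensor K V W)"
  shows "g (tensor_lift K V W U f t) = tensor_lift K V W U' (\<lambda>v w. g (f v w)) t"
proof (rule linear_maps_eqI[OF assms(1,2) _ _ _ assms(7)])
  have B: "(\<lambda>v w. g (f v w)) \<in> bilinear_maps K V W U'"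
    by (intro bilinear_mapsI linear_maps_comp[OF assms(6)])
      (auto intro: bilinear_mapsD[OF assms(5)])
  show "tensor_lift K V W U' (\<lambda>v w. g (f v w)) \<in> linear_maps K (tensor K V W) U'"
    by (rule tensor_lift_linear[OF assms(1,2,4) B])
  show "(\<lambda>t. g (tensor_lift K V W U f t)) \<in> linear_maps K (tensor K V W) U'"
    by (rule linear_maps_comp[OF assms(6) tensor_lift_linear[OF assms(1-3,5)]])
  show "g (tensor_lift K V W U f (pure K V W v w)) =
      tensor_lift K V W U' (\<lambda>v w. g (f v w)) (pure K V W v w)"
    if "v \<in> carrier V" "w \<in> carrier W" for v w
    using that by (simp add: tensor_lift_pure[OF assms(1-3,5)] tensor_lift_pure[OF assms(1,2,4) B])
qed

text \<open>Serves nested lifts, where an outer variable occurs in the inner integrand. For a fixed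
  \<open>t\<close> the identities hold on pure tensors and are stable under sums.\<close>

lemma tensor_lift_linear_param:
  assumes mods: "module K V" "module K W" "module K U" "module K X"
    and B: "\<And>x. x \<in> carrier X \<Longrightarrow> F x \<in> bilinear_maps K V W U"
    and L: "\<And>v w. \<lbrakk>v \<in> carrier V; w \<in> carrier W\<rbrakk> \<Longrightarrow> (\<lambda>x. F x v w) \<in> linear_maps K X U"
    and t: "t \<in> carrier (tensor K V W)"
  shows "(\<lambda>x. tensor_lift K V W U (F x) t) \<in> linear_maps K X U"
proof -
  interpret U: module K U by fact
  interpret X: module K X by fact
  note lin = linear_mapsD[OF tensor_lift_linear[OF mods(1-3) B]]
  note pure = tensor_lift_pure[OF mods(1-3) B]
  note LD = linear_mapsD[OF L]
  show ?thesis
  proof (rule linear_mapsI)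
    fix x assume "x \<in> carrier X"
    then show "tensor_lift K V W U (F x) t \<in> carrier U" using lin(1) t by blast
  next
    fix x y assume xy: "x \<in> carrier X" "y \<in> carrier X"
    then have xy': "x \<oplus>\<^bsub>X\<^esub> y \<in> carrier X" by simp
    show "tensor_lift K V W U (F (x \<oplus>\<^bsub>X\<^esub> y)) t =
        tensor_lift K V W U (F x) t \<oplus>\<^bsub>U\<^esub> tensor_lift K V W U (F y) t"
      using mods(1,2) t
    proof (induction rule: tensor_induct)
      case (pure v w)
      then show ?case
        using xy xy' by (simp add: tensor_lift_pure[OF mods(1-3) B] LD(2)[OF pure])
    next
      case (add s t)
      then show ?case
        using lin(1)[OF xy(1)] lin(1)[OF xy(2)]
        by (simp add: lin(2)[OF xy(1)] lin(2)[OF xy(2)] lin(2)[OF xy'] U.M.a_ac)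
    qed
  next
    fix a x assume ax: "a \<in> carrier K" "x \<in> carrier X"
    then have ax': "a \<odot>\<^bsub>X\<^esub> x \<in> carrier X" by simp
    show "tensor_lift K V W U (F (a \<odot>\<^bsub>X\<^esub> x)) t = a \<odot>\<^bsub>U\<^esub> tensor_lift K V W U (F x) t"
      using mods(1,2) t
    proof (induction rule: tensor_induct)
      case (pure v w)
      then show ?case
        using ax ax' by (simp add: tensor_lift_pure[OF mods(1-3) B] LD(3)[OF pure])
    next
      case (add s t)
      then show ?case
        using lin(1)[OF ax(2)] ax(1)
        by (simp add: lin(2)[OF ax(2)] lin(2)[OF ax'] U.smult_r_distr)
    qed
  qed
qed

lemma self_module_module: "cring K \<Longrightarrow> module K (self_module K)"
proof -
  assume "cring K"
  then interpret cring K .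
  show ?thesis
  proof (rule moduleI)
    show "abelian_group (self_module K)"
    proof (rule abelian_groupI)
      fix x assume "x \<in> carrier (self_module K)"
      then show "\<exists>y\<in>carrier (self_module K). y \<oplus>\<^bsub>self_module K\<^esub> x = \<zero>\<^bsub>self_module K\<^esub>"
        by (intro bexI[of _ "\<ominus>\<^bsub>K\<^esub> x"]) (auto simp: self_module_def l_neg)
    qed (auto simp: self_module_def a_ac)
  qed (auto simp: self_module_def l_distr r_distr m_assoc is_cring)
qed

lemma smult_linear_right:
  assumes "module K V" "a \<in> carrier K" "f \<in> linear_maps K X V"
  shows "(\<lambda>x. a \<odot>\<^bsub>V\<^esub> f x) \<in> linear_maps K X V"
proof -
  interpret V: module K V by fact
  show ?thesis
    using linear_mapsD[OF assms(3)] assms(2)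
    by (intro linear_mapsI)
      (simp_all add: V.smult_r_distr V.R.m_comm flip: V.smult_assoc1)
qed

lemma smult_linear_left:
  assumes "module K V" "v \<in> carrier V" "f \<in> linear_maps K X (self_module K)"
  shows "(\<lambda>x. f x \<odot>\<^bsub>V\<^esub> v) \<in> linear_maps K X V"
proof -
  interpret V: module K V by fact
  show ?thesis
    using linear_mapsD[OF assms(3)] assms(2)
    by (intro linear_mapsI) (simp_all add: self_module_def V.smult_l_distr V.smult_assoc1)
qed

text \<open>The variable whose linearity is in question may sit in a factor of a pure tensor, in a
  scalar, in the integrand of a lift or in the tensor being lifted; there is one rule for each
  position.\<close>

lemmas lin_intros = bilinear_mapsI linear_maps_id pure_linear_left pure_linear_right
  tensor_lift_linear_param tensor_lift_linear_arg smult_linear_left smult_linear_right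

lemma trilinear_lift:
  assumes mods: "module K A" "module K B" "module K C" "module K U"
    and F: "\<And>b c. \<lbrakk>b \<in> carrier B; c \<in> carrier C\<rbrakk> \<Longrightarrow> (\<lambda>a. F a b c) \<in> linear_maps K A U"
      "\<And>a c. \<lbrakk>a \<in> carrier A; c \<in> carrier C\<rbrakk> \<Longrightarrow> (\<lambda>b. F a b c) \<in> linear_maps K B U"
      "\<And>a b. \<lbrakk>a \<in> carrier A; b \<in> carrier B\<rbrakk> \<Longrightarrow> (\<lambda>c. F a b c) \<in> linear_maps K C U"
  shows trilinear_lift_right:
      "(\<lambda>a. tensor_lift K B C U (F a)) \<in> bilinear_maps K A (tensor K B C) U"
    and trilinear_lift_left:
      "(\<lambda>t c. tensor_lift K A B U (\<lambda>a b. F a b c) t) \<in> bilinear_maps K (tensor K A B) C U"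
  using mods by (auto intro!: lin_intros tensor_module F tensor_lift_linear)

text \<open>The linear map induced by \<open>F\<close> is pushed through the two lifts that make up
  \<open>tensor_assoc\<close> and evaluated on \<open>a \<otimes> (b \<otimes> c)\<close>. Equations
  between differently bracketed triple tensors thereby become equations between iterated
  lifts.\<close>

lemma tensor_assoc_lift:
  assumes mods: "module K A" "module K B" "module K C" "module K U"
    and F: "\<And>b c. \<lbrakk>b \<in> carrier B; c \<in> carrier C\<rbrakk> \<Longrightarrow> (\<lambda>a. F a b c) \<in> linear_maps K A U"
      "\<And>a c. \<lbrakk>a \<in> carrier A; c \<in> carrier C\<rbrakk> \<Longrightarrow> (\<lambda>b. F a b c) \<in> linear_maps K B U"
      "\<And>a b. \<lbrakk>a \<in> carrier A; b \<in> carrier B\<rbrakk> \<Longrightarrow> (\<lambda>c. F a b c) \<in> linear_maps K C U"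
    and s: "s \<in> carrier (tensor K (tensor K A B) C)"
  shows "tensor_lift K A (tensor K B C) U (\<lambda>a. tensor_lift K B C U (F a)) (tensor_assoc K A B C s) =
    tensor_lift K (tensor K A B) C U (\<lambda>t c. tensor_lift K A B U (\<lambda>a b. F a b c) t) s"
proof -
  let ?AB = "tensor K A B" and ?BC = "tensor K B C"
  let ?T = "tensor K A ?BC"
  let ?G = "\<lambda>a. tensor_lift K B C U (F a)"
  let ?as = "\<lambda>c a b. pure K A ?BC a (pure K B C b c)"
  have mAB: "module K ?AB" and mBC: "module K ?BC" and mT: "module K ?T"
    using mods by (auto intro: tensor_module)
  note mods' = mods mAB mBC mT
  have BF: "F a \<in> bilinear_maps K B C U" if "a \<in> carrier A" for a
    using that F by (auto intro!: bilinear_mapsI)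
  have BG: "?G \<in> bilinear_maps K A ?BC U"
    by (rule trilinear_lift_right) (use mods F in auto)
  have Bas: "?as c \<in> bilinear_maps K A B ?T" if "c \<in> carrier C" for c
    using that mods' by (auto intro!: lin_intros pure_closed)
  have Bas2: "(\<lambda>t c. tensor_lift K A B ?T (?as c) t) \<in> bilinear_maps K ?AB C ?T"
    using mods' Bas
    by (intro bilinear_mapsI tensor_lift_linear_param tensor_lift_linear_arg linear_maps_id)
      (auto intro!: lin_intros pure_closed)
  have "tensor_lift K A ?BC U ?G (tensor_assoc K A B C s) =
      tensor_lift K ?AB C U (\<lambda>t c. tensor_lift K A ?BC U ?G (tensor_lift K A B ?T (?as c) t)) s"
    unfolding tensor_assoc_def
    by (rule tensor_lift_comp[OF mAB mods(3) mT mods(4) Bas2 tensor_lift_linear[OF mods(1) mBC mods(4) BG] s])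
  also have "\<dots> = tensor_lift K ?AB C U (\<lambda>t c. tensor_lift K A B U (\<lambda>a b. F a b c) t) s"
  proof (rule tensor_lift_cong[OF refl refl refl refl])
    fix t c assume t: "t \<in> carrier ?AB" and c: "c \<in> carrier C"
    have "tensor_lift K A ?BC U ?G (tensor_lift K A B ?T (?as c) t) =
        tensor_lift K A B U (\<lambda>a b. tensor_lift K A ?BC U ?G (?as c a b)) t"
      by (rule tensor_lift_comp[OF mods(1,2) mT mods(4) Bas[OF c] tensor_lift_linear[OF mods(1) mBC mods(4) BG] t])
    also have "\<dots> = tensor_lift K A B U (\<lambda>a b. F a b c) t"
      by (rule tensor_lift_cong[OF refl refl refl refl])
        (use c mods in \<open>simp add: tensor_lift_pure[OF mods(1) mBC mods(4) BG] pure_closed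
          tensor_lift_pure[OF mods(2,3,4) BF]\<close>)
    finally show "tensor_lift K A ?BC U ?G (tensor_lift K A B ?T (?as c) t) =
      tensor_lift K A B U (\<lambda>a b. F a b c) t" .
  qed
  finally show ?thesis .
qed

lemma tensor_map_bilinear:
  assumes "module K V'" "module K W'" "f \<in> linear_maps K V V'" "g \<in> linear_maps K W W'"
  shows "(\<lambda>v w. pure K V' W' (f v) (g w)) \<in> bilinear_maps K V W (tensor K V' W')"
  using assms by (auto intro!: lin_intros simp: linear_mapsD)

lemma tensor_map_closed:
  assumes "module K V" "module K W" "module K V'" "module K W'"
    "f \<in> linear_maps K V V'" "g \<in> linear_maps K W W'" "t \<in> carrier (tensor K V W)"
  shows "tensor_map K V W V' W' f g t \<in> carrier (tensor K V' W')"
  unfolding tensor_map_def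
  by (rule tensor_lift_closed) (use assms tensor_map_bilinear tensor_module in auto)

lemma tensor_map_linear_arg:
  assumes "module K V" "module K W" "module K V'" "module K W'"
    and "f \<in> linear_maps K V V'" "g \<in> linear_maps K W W'" "k \<in> linear_maps K X (tensor K V W)"
  shows "(\<lambda>x. tensor_map K V W V' W' f g (k x)) \<in> linear_maps K X (tensor K V' W')"
  unfolding tensor_map_def
  by (rule tensor_lift_linear_arg) (use assms tensor_map_bilinear tensor_module in auto)

lemma tensor_map_lift:
  assumes mods: "module K V" "module K W" "module K V'" "module K W'" "module K U"
    and "f \<in> linear_maps K V V'" "g \<in> linear_maps K W W'"
    and G: "G \<in> bilinear_maps K V' W' U" and t: "t \<in> carrier (tensor K V W)"
  shows "tensor_lift K V' W' U G (tensor_map K V W V' W' f g t) =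
    tensor_lift K V W U (\<lambda>v w. G (f v) (g w)) t"
proof -
  have "tensor_lift K V' W' U G (tensor_map K V W V' W' f g t) =
      tensor_lift K V W U (\<lambda>v w. tensor_lift K V' W' U G (pure K V' W' (f v) (g w))) t"
    unfolding tensor_map_def
    by (rule tensor_lift_comp[OF mods(1,2) _ mods(5) tensor_map_bilinear tensor_lift_linear[OF mods(3-5) G] t])
      (use assms tensor_module in auto)
  also have "\<dots> = tensor_lift K V W U (\<lambda>v w. G (f v) (g w)) t"
    by (rule tensor_lift_cong[OF refl refl refl refl])
      (use assms in \<open>simp add: tensor_lift_pure[OF mods(3-5) G] linear_mapsD\<close>)
  finally show ?thesis .
qed

text \<open>Independent Sweedler sums commute: by linearity in \<open>t\<close> it is enough to take
  \<open>t\<close> pure, where the lift over \<open>t\<close> disappears on both sides.\<close>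

lemma tensor_lift_swap:
  assumes mods: "module K V" "module K W" "module K V'" "module K W'" "module K U"
    and F: "\<And>v w. \<lbrakk>v \<in> carrier V; w \<in> carrier W\<rbrakk> \<Longrightarrow> F v w \<in> bilinear_maps K V' W' U"
    and F': "\<And>v' w'. \<lbrakk>v' \<in> carrier V'; w' \<in> carrier W'\<rbrakk> \<Longrightarrow>
      (\<lambda>v w. F v w v' w') \<in> bilinear_maps K V W U"
    and s: "s \<in> carrier (tensor K V' W')" and t: "t \<in> carrier (tensor K V W)"
  shows "tensor_lift K V W U (\<lambda>v w. tensor_lift K V' W' U (F v w) s) t =
    tensor_lift K V' W' U (\<lambda>v' w'. tensor_lift K V W U (\<lambda>v w. F v w v' w') t) s"
proof -
  have F1: "(\<lambda>v'. F v w v' w') \<in> linear_maps K V' U"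
    if "v \<in> carrier V" "w \<in> carrier W" "w' \<in> carrier W'" for v w w'
    using bilinear_mapsD(2)[OF F] that by blast
  have F2: "(\<lambda>w'. F v w v' w') \<in> linear_maps K W' U"
    if "v \<in> carrier V" "w \<in> carrier W" "v' \<in> carrier V'" for v w v'
    using bilinear_mapsD(1)[OF F] that by blast
  have F3: "(\<lambda>v. F v w v' w') \<in> linear_maps K V U"
    if "w \<in> carrier W" "v' \<in> carrier V'" "w' \<in> carrier W'" for w v' w'
    using bilinear_mapsD(2)[OF F'] that by blast
  have F4: "(\<lambda>w. F v w v' w') \<in> linear_maps K W U"
    if "v \<in> carrier V" "v' \<in> carrier V'" "w' \<in> carrier W'" for v v' w'
    using bilinear_mapsD(1)[OF F'] that by blast
  have B: "(\<lambda>v w. tensor_lift K V' W' U (F v w) s) \<in> bilinear_maps K V W U"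
    using mods s F1 F2 F3 F4 by (intro bilinear_mapsI tensor_lift_linear_param) auto
  show ?thesis
  proof (rule linear_maps_eqI[OF mods(1,2) _ _ _ t])
    show "tensor_lift K V W U (\<lambda>v w. tensor_lift K V' W' U (F v w) s)
        \<in> linear_maps K (tensor K V W) U"
      by (rule tensor_lift_linear[OF mods(1,2,5) B])
    show "(\<lambda>t. tensor_lift K V' W' U (\<lambda>v' w'. tensor_lift K V W U (\<lambda>v w. F v w v' w') t) s)
        \<in> linear_maps K (tensor K V W) U"
      using mods s F' F1 F2 F3 F4 tensor_module
      by (intro tensor_lift_linear_param tensor_lift_linear bilinear_mapsI) auto
    fix v w assume vw: "v \<in> carrier V" "w \<in> carrier W"
    have "tensor_lift K V' W' U (\<lambda>v' w'. tensor_lift K V W U (\<lambda>v w. F v w v' w') (pure K V W v w)) s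
        = tensor_lift K V' W' U (F v w) s"
      by (rule tensor_lift_cong[OF refl refl refl refl])
        (simp add: tensor_lift_pure[OF mods(1,2,5) F'] vw)
    then show "tensor_lift K V W U (\<lambda>v w. tensor_lift K V' W' U (F v w) s) (pure K V W v w) =
        tensor_lift K V' W' U (\<lambda>v' w'. tensor_lift K V W U (\<lambda>v w. F v w v' w') (pure K V W v w)) s"
      by (simp add: tensor_lift_pure[OF mods(1,2,5) B] vw)
  qed
qed

text \<open>Coassociativity evaluated under a trilinear \<open>F\<close>. In this form the third leg
  may come from the coproduct of the first leg or from a second coaction, without any triple tensor
  appearing.\<close>

lemma (in left_comodule) coact_coassoc_lift:
  assumes U: "module K U" and v: "v \<in> carrier V"
    and F: "\<And>b y. \<lbrakk>b \<in> carrier C; y \<in> carrier V\<rbrakk> \<Longrightarrow> (\<lambda>a. F a b y) \<in> linear_maps K C U"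
      "\<And>a y. \<lbrakk>a \<in> carrier C; y \<in> carrier V\<rbrakk> \<Longrightarrow> (\<lambda>b. F a b y) \<in> linear_maps K C U"
      "\<And>a b. \<lbrakk>a \<in> carrier C; b \<in> carrier C\<rbrakk> \<Longrightarrow> (\<lambda>y. F a b y) \<in> linear_maps K V U"
  shows "tensor_lift K C V U (\<lambda>a y. tensor_lift K C C U (\<lambda>a1 a2. F a1 a2 y) (\<Delta> a)) (\<rho> v) =
    tensor_lift K C V U (\<lambda>a y. tensor_lift K C V U (\<lambda>b z. F a b z) (\<rho> y)) (\<rho> v)"
proof -
  note C = module_axioms and V = V.module_axioms
  note mCC = tensor_module[OF C C] and mCV = tensor_module[OF C V]
  have rv: "\<rho> v \<in> carrier (tensor K C V)" using linear_mapsD(1)[OF coact_linear v] .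
  have idC: "id \<in> linear_maps K C C" and idV: "id \<in> linear_maps K V V"
    unfolding id_def by (rule linear_maps_id)+
  note L = trilinear_lift_left[OF C C V U F] and R = trilinear_lift_right[OF C C V U F]
  have "tensor_lift K C V U (\<lambda>a y. tensor_lift K C C U (\<lambda>a1 a2. F a1 a2 y) (\<Delta> a)) (\<rho> v) =
      tensor_lift K (tensor K C C) V U (\<lambda>t y. tensor_lift K C C U (\<lambda>a1 a2. F a1 a2 y) t)
        (tensor_map K C V (tensor K C C) V \<Delta> id (\<rho> v))"
    by (subst tensor_map_lift[OF C V mCC V U comult_linear idV L rv]) simp_all
  also have "\<dots> = tensor_lift K C (tensor K C V) U (\<lambda>a. tensor_lift K C V U (F a))
      (tensor_assoc K C C V (tensor_map K C V (tensor K C C) V \<Delta> id (\<rho> v)))"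
    by (rule tensor_assoc_lift[OF C C V U F tensor_map_closed[OF C V mCC V comult_linear idV rv], symmetric])
  also have "\<dots> = tensor_lift K C (tensor K C V) U (\<lambda>a. tensor_lift K C V U (F a))
      (tensor_map K C V C (tensor K C V) id \<rho> (\<rho> v))"
    by (simp only: coact_coassoc[OF v])
  also have "\<dots> = tensor_lift K C V U (\<lambda>a y. tensor_lift K C V U (\<lambda>b z. F a b z) (\<rho> y)) (\<rho> v)"
    by (subst tensor_map_lift[OF C V C mCV U idC coact_linear R rv]) simp_all
  finally show ?thesis .
qed

text \<open>Lets the coassociativity rule for coactions serve for comultiplications as well.\<close>

lemma (in coalgebra) self_comodule: "left_comodule K C \<Delta> \<epsilon> C \<Delta>"
  by unfold_locales (simp_all add: comult_linear coassoc counit_left)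

section \<open>Graded Hopf quasigroups\<close>

lemma (in quasigroup) qinv_simps:
  assumes p: "p \<in> carrier Q"
  shows "qinv Q p \<otimes> p = \<one>" and "p \<otimes> qinv Q p = \<one>" and "qinv Q (qinv Q p) = p"
    and "q \<in> carrier Q \<Longrightarrow> p \<otimes> (qinv Q p \<otimes> q) = q"
    and "q \<in> carrier Q \<Longrightarrow> (q \<otimes> qinv Q p) \<otimes> p = q"
proof -
  note i = qinv[OF p] and j = qinv[OF qinv(1)[OF p]]
  show l: "qinv Q p \<otimes> p = \<one>" using i(2)[OF one_closed] right_one[OF p] by simp
  show "p \<otimes> qinv Q p = \<one>" using i(3)[OF one_closed] left_one[OF p] by simp
  \<comment> \<open>The inverse of \<open>qinv Q p\<close> cancels the left factor of
    \<open>qinv Q p \<otimes> p\<close>, and that product is \<open>\<one>\<close>.\<close>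
  show jp: "qinv Q (qinv Q p) = p" using j(2)[OF p] l right_one[OF j(1)] by simp
  show "q \<in> carrier Q \<Longrightarrow> p \<otimes> (qinv Q p \<otimes> q) = q" using j(2) jp by simp
  show "q \<in> carrier Q \<Longrightarrow> (q \<otimes> qinv Q p) \<otimes> p = q" using j(3) jp by simp
qed

lemma tensor_comult_pure:
  assumes "module K C" "module K D"
    and "\<Delta>C \<in> linear_maps K C (tensor K C C)" "\<Delta>D \<in> linear_maps K D (tensor K D D)"
    and "c \<in> carrier C" "d \<in> carrier D"
  shows "tensor_comult K C \<Delta>C D \<Delta>D (pure K C D c d) =
    (let CD = tensor K C D; T = tensor K CD CD in
      tensor_lift K C C T (\<lambda>c1 c2. tensor_lift K D D T
        (\<lambda>d1 d2. pure K CD CD (pure K C D c1 d1) (pure K C D c2 d2)) (\<Delta>D d)) (\<Delta>C c))"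
  unfolding tensor_comult_def Let_def
  by (rule tensor_lift_pure; (intro lin_intros)?)
    (use assms in \<open>simp_all add: tensor_module pure_closed linear_mapsD linear_maps_comp\<close>)

context graded_hopf_quasigroup
begin

lemmas index_simps = mult_closed quasigroup.one_closed[OF quasigroup_axioms] left_one right_one qinv qinv_simps

lemma H_module: "p \<in> carrier Q \<Longrightarrow> module K (H p)"
  using component_coalgebra by (simp add: coalgebra_def)

lemma K_closed: "carrier (self_module K) = carrier K"
  by (simp add: self_module_def)

lemma comult_lin: "p \<in> carrier Q \<Longrightarrow> \<Delta> p \<in> linear_maps K (H p) (tensor K (H p) (H p))"
  by (rule coalgebra.comult_linear[OF component_coalgebra])

lemma counit_lin: "p \<in> carrier Q \<Longrightarrow> \<epsilon> p \<in> linear_maps K (H p) (self_module K)"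
  by (rule coalgebra.counit_linear[OF component_coalgebra])

lemma mult_lin:
  "\<lbrakk>p \<in> carrier Q; q \<in> carrier Q\<rbrakk> \<Longrightarrow> m p q \<in> linear_maps K (tensor K (H p) (H q)) (H (p \<otimes>\<^bsub>Q\<^esub> q))"
  using mult_coalgebra_map by (simp add: coalgebra_maps_def)

lemma unit_lin: "\<mu> \<in> linear_maps K (self_module K) (H \<one>\<^bsub>Q\<^esub>)"
  using unit_coalgebra_map by (simp add: coalgebra_maps_def)

text \<open>Indices enter the following rules through equations such as \<open>r = p \<otimes> q\<close>, because the
  index of a component is in general only provably equal to the one that the rule produces.\<close>

lemma hopf_closed:
  shows comult_closed: "\<lbrakk>p \<in> carrier Q; h \<in> carrier (H p)\<rbrakk> \<Longrightarrow>
      \<Delta> p h \<in> carrier (tensor K (H p) (H p))"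
    and counit_closed: "\<lbrakk>p \<in> carrier Q; h \<in> carrier (H p)\<rbrakk> \<Longrightarrow> \<epsilon> p h \<in> carrier K"
    and antipode_closed: "\<lbrakk>p \<in> carrier Q; h \<in> carrier (H p); r = qinv Q p\<rbrakk> \<Longrightarrow>
      S p h \<in> carrier (H r)"
    and prd_closed: "\<lbrakk>p \<in> carrier Q; q \<in> carrier Q; h \<in> carrier (H p); g \<in> carrier (H q);
      r = p \<otimes>\<^bsub>Q\<^esub> q\<rbrakk> \<Longrightarrow> prd p q h g \<in> carrier (H r)"
    and unit_closed: "\<mu> \<one>\<^bsub>K\<^esub> \<in> carrier (H \<one>\<^bsub>Q\<^esub>)"
proof -
  show "\<lbrakk>p \<in> carrier Q; h \<in> carrier (H p)\<rbrakk> \<Longrightarrow> \<Delta> p h \<in> carrier (tensor K (H p) (H p))"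
    by (rule linear_mapsD(1)[OF comult_lin])
  show "\<lbrakk>p \<in> carrier Q; h \<in> carrier (H p)\<rbrakk> \<Longrightarrow> \<epsilon> p h \<in> carrier K"
    using linear_mapsD(1)[OF counit_lin] K_closed by blast
  show "\<lbrakk>p \<in> carrier Q; h \<in> carrier (H p); r = qinv Q p\<rbrakk> \<Longrightarrow> S p h \<in> carrier (H r)"
    using linear_mapsD(1)[OF antipode_linear] by blast
  show "\<lbrakk>p \<in> carrier Q; q \<in> carrier Q; h \<in> carrier (H p); g \<in> carrier (H q);
      r = p \<otimes>\<^bsub>Q\<^esub> q\<rbrakk> \<Longrightarrow> prd p q h g \<in> carrier (H r)"
    using linear_mapsD(1)[OF mult_lin] pure_closed[OF H_module H_module] by blast
  show "\<mu> \<one>\<^bsub>K\<^esub> \<in> carrier (H \<one>\<^bsub>Q\<^esub>)"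
    by (rule linear_mapsD(1)[OF unit_lin]) (simp add: K_closed)
qed

lemma hopf_linear:
  assumes p: "p \<in> carrier Q"
  shows comult_linear_comp: "f \<in> linear_maps K X (H p) \<Longrightarrow>
      (\<lambda>x. \<Delta> p (f x)) \<in> linear_maps K X (tensor K (H p) (H p))"
    and counit_linear_comp: "f \<in> linear_maps K X (H p) \<Longrightarrow>
      (\<lambda>x. \<epsilon> p (f x)) \<in> linear_maps K X (self_module K)"
    and antipode_linear_comp: "\<lbrakk>f \<in> linear_maps K X (H p); r = qinv Q p\<rbrakk> \<Longrightarrow>
      (\<lambda>x. S p (f x)) \<in> linear_maps K X (H r)"
    and mult_linear_comp: "\<lbrakk>q \<in> carrier Q; g \<in> linear_maps K X (tensor K (H p) (H q));
      r = p \<otimes>\<^bsub>Q\<^esub> q\<rbrakk> \<Longrightarrow> (\<lambda>x. m p q (g x)) \<in> linear_maps K X (H r)"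
  using linear_maps_comp[OF comult_lin[OF p], of f] linear_maps_comp[OF counit_lin[OF p], of f]
    linear_maps_comp[OF antipode_linear[OF p], of f] linear_maps_comp[OF mult_lin[OF p], of q g]
  by auto

lemmas hopf_intros = lin_intros hopf_linear
lemmas hopf_simps = index_simps H_module tensor_module pure_closed hopf_closed

section \<open>Coalgebra laws as rules for iterated lifts\<close>

lemma coassoc_lift:
  assumes p: "p \<in> carrier Q" and h: "h \<in> carrier (H p)" and U: "module K U"
    and F: "\<And>b c. \<lbrakk>b \<in> carrier (H p); c \<in> carrier (H p)\<rbrakk> \<Longrightarrow>
        (\<lambda>a. F a b c) \<in> linear_maps K (H p) U"
      "\<And>a c. \<lbrakk>a \<in> carrier (H p); c \<in> carrier (H p)\<rbrakk> \<Longrightarrow>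
        (\<lambda>b. F a b c) \<in> linear_maps K (H p) U"
      "\<And>a b. \<lbrakk>a \<in> carrier (H p); b \<in> carrier (H p)\<rbrakk> \<Longrightarrow>
        (\<lambda>c. F a b c) \<in> linear_maps K (H p) U"
  shows "tensor_lift K (H p) (H p) U
      (\<lambda>a b. tensor_lift K (H p) (H p) U (\<lambda>a1 a2. F a1 a2 b) (\<Delta> p a)) (\<Delta> p h) =
    tensor_lift K (H p) (H p) U
      (\<lambda>a b. tensor_lift K (H p) (H p) U (\<lambda>b1 b2. F a b1 b2) (\<Delta> p b)) (\<Delta> p h)"
  by (rule left_comodule.coact_coassoc_lift[OF coalgebra.self_comodule[OF component_coalgebra[OF p]]])
    (use assms in auto)

text \<open>The counit law under a surrounding linear expression \<open>g\<close>. Computations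
  produce \<open>\<epsilon>(a)\<close> as an outer scalar; linearity moves it onto the other leg,
  which gives the shape matched here.\<close>

lemma counit_left_lift:
  assumes p: "p \<in> carrier Q" and h: "h \<in> carrier (H p)" and U: "module K U"
    and g: "g \<in> linear_maps K (H p) U"
  shows "tensor_lift K (H p) (H p) U (\<lambda>a b. g (\<epsilon> p a \<odot>\<^bsub>H p\<^esub> b)) (\<Delta> p h) = g h"
proof -
  have "g (tensor_lift K (H p) (H p) (H p) (\<lambda>a b. \<epsilon> p a \<odot>\<^bsub>H p\<^esub> b) (\<Delta> p h)) =
      tensor_lift K (H p) (H p) U (\<lambda>a b. g (\<epsilon> p a \<odot>\<^bsub>H p\<^esub> b)) (\<Delta> p h)"
    by (rule tensor_lift_comp[OF _ _ _ U _ g]; (intro hopf_intros)?)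
      (use p h in \<open>simp_all add: hopf_simps\<close>)
  then show ?thesis by (simp add: coalgebra.counit_left[OF component_coalgebra] p h)
qed

lemma counit_right_lift:
  assumes p: "p \<in> carrier Q" and h: "h \<in> carrier (H p)" and U: "module K U"
    and g: "g \<in> linear_maps K (H p) U"
  shows "tensor_lift K (H p) (H p) U (\<lambda>a b. g (\<epsilon> p b \<odot>\<^bsub>H p\<^esub> a)) (\<Delta> p h) = g h"
proof -
  have "g (tensor_lift K (H p) (H p) (H p) (\<lambda>a b. \<epsilon> p b \<odot>\<^bsub>H p\<^esub> a) (\<Delta> p h)) =
      tensor_lift K (H p) (H p) U (\<lambda>a b. g (\<epsilon> p b \<odot>\<^bsub>H p\<^esub> a)) (\<Delta> p h)"
    by (rule tensor_lift_comp[OF _ _ _ U _ g]; (intro hopf_intros)?)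
      (use p h in \<open>simp_all add: hopf_simps\<close>)
  then show ?thesis by (simp add: coalgebra.counit_right[OF component_coalgebra] p h)
qed

text \<open>Multiplication is a coalgebra map for the tensor product coalgebra. On a pure tensor
  that comultiplication is a nested lift, and the map \<open>m \<otimes> m\<close> is moved through
  both layers.\<close>

lemma comult_prd:
  assumes "p \<in> carrier Q" "q \<in> carrier Q" "h \<in> carrier (H p)" "g \<in> carrier (H q)"
  defines "T \<equiv> tensor K (H (p \<otimes>\<^bsub>Q\<^esub> q)) (H (p \<otimes>\<^bsub>Q\<^esub> q))"
  shows "\<Delta> (p \<otimes>\<^bsub>Q\<^esub> q) (prd p q h g) =
    tensor_lift K (H p) (H p) T (\<lambda>h1 h2. tensor_lift K (H q) (H q) T
      (\<lambda>g1 g2. pure K (H (p \<otimes>\<^bsub>Q\<^esub> q)) (H (p \<otimes>\<^bsub>Q\<^esub> q)) (prd p q h1 g1) (prd p q h2 g2)) (\<Delta> q g)) (\<Delta> p h)"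
proof -
  let ?HH = "tensor K (H p) (H q)" and ?r = "p \<otimes>\<^bsub>Q\<^esub> q"
  let ?T = "tensor K ?HH ?HH"
  let ?mm = "tensor_map K ?HH ?HH (H ?r) (H ?r) (m p q) (m p q)"
  let ?P = "\<lambda>h1 h2 g1 g2. pure K ?HH ?HH (pure K (H p) (H q) h1 g1) (pure K (H p) (H q) h2 g2)"
  note s = assms(1-4) hopf_simps
  have mm: "?mm \<in> linear_maps K ?T T"
    unfolding tensor_map_def T_def
    by (rule tensor_lift_linear; (intro hopf_intros)?)
      (simp_all add: s linear_mapsD(1)[OF mult_lin])
  have mT: "module K T" "module K ?T" by (simp_all add: T_def s)
  have "\<Delta> ?r (prd p q h g) = ?mm (tensor_comult K (H p) (\<Delta> p) (H q) (\<Delta> q) (pure K (H p) (H q) h g))"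
    using mult_coalgebra_map[OF assms(1,2)] by (simp add: coalgebra_maps_def s)
  also have "\<dots> = ?mm (tensor_lift K (H p) (H p) ?T (\<lambda>h1 h2. tensor_lift K (H q) (H q) ?T
      (?P h1 h2) (\<Delta> q g)) (\<Delta> p h))"
    by (subst tensor_comult_pure) (simp_all add: s comult_lin Let_def)
  also have "\<dots> = tensor_lift K (H p) (H p) T (\<lambda>h1 h2. ?mm (tensor_lift K (H q) (H q) ?T
      (?P h1 h2) (\<Delta> q g))) (\<Delta> p h)"
    by (rule tensor_lift_comp[OF _ _ mT(2,1) _ mm]; (intro hopf_intros)?) (simp_all add: s)
  also have "\<dots> = tensor_lift K (H p) (H p) T (\<lambda>h1 h2. tensor_lift K (H q) (H q) T
      (\<lambda>g1 g2. ?mm (?P h1 h2 g1 g2)) (\<Delta> q g)) (\<Delta> p h)"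
    by (rule tensor_lift_cong[OF refl refl refl refl],
        rule tensor_lift_comp[OF _ _ mT(2,1) _ mm]; (intro hopf_intros)?) (simp_all add: s)
  also have "\<dots> = tensor_lift K (H p) (H p) T (\<lambda>h1 h2. tensor_lift K (H q) (H q) T
      (\<lambda>g1 g2. pure K (H ?r) (H ?r) (prd p q h1 g1) (prd p q h2 g2)) (\<Delta> q g)) (\<Delta> p h)"
    unfolding tensor_map_def T_def
    by (intro tensor_lift_cong refl, subst tensor_lift_pure; (intro hopf_intros)?)
      (simp_all add: s linear_mapsD(1)[OF mult_lin])
  finally show ?thesis .
qed

lemma comult_unit: "\<Delta> \<one>\<^bsub>Q\<^esub> (\<mu> \<one>\<^bsub>K\<^esub>) = pure K (H \<one>\<^bsub>Q\<^esub>) (H \<one>\<^bsub>Q\<^esub>) (\<mu> \<one>\<^bsub>K\<^esub>) (\<mu> \<one>\<^bsub>K\<^esub>)"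
proof -
  have "\<Delta> \<one>\<^bsub>Q\<^esub> (\<mu> \<one>\<^bsub>K\<^esub>) = tensor_map K (self_module K) (self_module K) (H \<one>\<^bsub>Q\<^esub>) (H \<one>\<^bsub>Q\<^esub>) \<mu> \<mu>
      (pure K (self_module K) (self_module K) \<one>\<^bsub>K\<^esub> \<one>\<^bsub>K\<^esub>)"
    using unit_coalgebra_map by (simp add: coalgebra_maps_def base_comult_def K_closed)
  also have "\<dots> = pure K (H \<one>\<^bsub>Q\<^esub>) (H \<one>\<^bsub>Q\<^esub>) (\<mu> \<one>\<^bsub>K\<^esub>) (\<mu> \<one>\<^bsub>K\<^esub>)"
    unfolding tensor_map_def
    by (rule tensor_lift_pure)
      (use self_module_module[OF is_cring] unit_lin in
        \<open>auto simp: hopf_simps K_closed intro!: tensor_map_bilinear\<close>)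
  finally show ?thesis .
qed

section \<open>The antipode and the comultiplication\<close>

text \<open>The first left antipode axiom with \<open>g\<close> the unit.\<close>

lemma antipode_convolution:
  assumes "p \<in> carrier Q" "h \<in> carrier (H p)"
  shows "tensor_lift K (H p) (H p) (H \<one>\<^bsub>Q\<^esub>) (\<lambda>a b. prd (qinv Q p) p (S p a) b) (\<Delta> p h) =
    \<epsilon> p h \<odot>\<^bsub>H \<one>\<^bsub>Q\<^esub>\<^esub> \<mu> \<one>\<^bsub>K\<^esub>"
proof -
  have "tensor_lift K (H p) (H p) (H \<one>\<^bsub>Q\<^esub>) (\<lambda>a b. prd (qinv Q p) p (S p a) b) (\<Delta> p h) =
      tensor_lift K (H p) (H p) (H \<one>\<^bsub>Q\<^esub>)
        (\<lambda>a b. prd (qinv Q p) (p \<otimes>\<^bsub>Q\<^esub> \<one>\<^bsub>Q\<^esub>) (S p a) (prd p \<one>\<^bsub>Q\<^esub> b (\<mu> \<one>\<^bsub>K\<^esub>))) (\<Delta> p h)"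
    by (rule tensor_lift_cong) (simp_all add: assms hopf_simps unit_right)
  also have "\<dots> = \<epsilon> p h \<odot>\<^bsub>H \<one>\<^bsub>Q\<^esub>\<^esub> \<mu> \<one>\<^bsub>K\<^esub>"
    by (rule antipode_left_1) (simp_all add: assms hopf_simps)
  finally show ?thesis .
qed

text \<open>In Sweedler notation, \<open>S(h\<^sub>(\<^sub>1\<^sub>))\<^sub>(\<^sub>1\<^sub>) h\<^sub>(\<^sub>2\<^sub>) \<otimes> S(h\<^sub>(\<^sub>1\<^sub>))\<^sub>(\<^sub>2\<^sub>) = 1 \<otimes> S(h)\<close>:
  this replaces the anticomultiplicativity of the antipode. It follows by expanding
  \<open>\<Delta>(S(h\<^sub>(\<^sub>1\<^sub>)) h\<^sub>(\<^sub>2\<^sub>)) (1 \<otimes> S(h\<^sub>(\<^sub>3\<^sub>)))\<close> in two ways.\<close>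

lemma antipode_comult:
  assumes p: "p \<in> carrier Q" and h: "h \<in> carrier (H p)"
  defines "r \<equiv> qinv Q p"
  defines "T \<equiv> tensor K (H \<one>\<^bsub>Q\<^esub>) (H r)"
  shows "tensor_lift K (H p) (H p) T (\<lambda>a b. tensor_lift K (H r) (H r) T
      (\<lambda>c d. pure K (H \<one>\<^bsub>Q\<^esub>) (H r) (prd r p c b) d) (\<Delta> r (S p a))) (\<Delta> p h) =
    pure K (H \<one>\<^bsub>Q\<^esub>) (H r) (\<mu> \<one>\<^bsub>K\<^esub>) (S p h)"
proof -
  let ?HH = "H p" and ?e = "\<mu> \<one>\<^bsub>K\<^esub>"
  have r: "r \<in> carrier Q" "r \<otimes>\<^bsub>Q\<^esub> p = \<one>\<^bsub>Q\<^esub>" "p \<otimes>\<^bsub>Q\<^esub> r = \<one>\<^bsub>Q\<^esub>" "qinv Q r = p" "qinv Q p = r"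
    using p by (simp_all add: r_def index_simps)
  have mT: "module K T" by (simp add: T_def hopf_simps r)
  let ?P = "\<lambda>x1 x2 y1 y2 s. pure K (H \<one>\<^bsub>Q\<^esub>) (H r) (prd r p x1 y1) (prd \<one>\<^bsub>Q\<^esub> r (prd r p x2 y2) s)"
  \<comment> \<open>\<open>?F a1 a2 b\<close> is
    \<open>\<Delta>(S(a1) a2) (1 \<otimes> S(b))\<close> written out in legs, and
    \<open>?G s\<close> multiplies the second leg by \<open>s\<close> from the right.
    \<open>Gprd\<close> below connects the two.\<close>
  let ?F = "\<lambda>a1 a2 b. tensor_lift K (H r) (H r) T (\<lambda>x1 x2. tensor_lift K (H p) (H p) T
    (\<lambda>y1 y2. ?P x1 x2 y1 y2 (S p b)) (\<Delta> p a2)) (\<Delta> r (S p a1))"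
  let ?G = "\<lambda>s. tensor_lift K (H \<one>\<^bsub>Q\<^esub>) (H \<one>\<^bsub>Q\<^esub>) T (\<lambda>c d. pure K (H \<one>\<^bsub>Q\<^esub>) (H r) c (prd \<one>\<^bsub>Q\<^esub> r d s))"
  let ?T1 = "tensor K (H \<one>\<^bsub>Q\<^esub>) (H \<one>\<^bsub>Q\<^esub>)"
  note s = p h r hopf_simps
  note s = s mT
  have BG: "(\<lambda>c d. pure K (H \<one>\<^bsub>Q\<^esub>) (H r) c (prd \<one>\<^bsub>Q\<^esub> r d s)) \<in> bilinear_maps K (H \<one>\<^bsub>Q\<^esub>) (H \<one>\<^bsub>Q\<^esub>) T"
    if "s \<in> carrier (H r)" for s
    unfolding T_def by (intro hopf_intros) (simp_all add: s that)
  have G: "?G s \<in> linear_maps K (tensor K (H \<one>\<^bsub>Q\<^esub>) (H \<one>\<^bsub>Q\<^esub>)) T" if "s \<in> carrier (H r)" for s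
    by (rule tensor_lift_linear[OF _ _ _ BG]) (simp_all add: s that)
  have GD: "(\<lambda>x. ?G s (\<Delta> \<one>\<^bsub>Q\<^esub> x)) \<in> linear_maps K (H \<one>\<^bsub>Q\<^esub>) T" if "s \<in> carrier (H r)" for s
    by (rule linear_maps_comp[OF G comult_lin]) (simp_all add: s that)
  have Gprd: "?G s (\<Delta> \<one>\<^bsub>Q\<^esub> (prd r p x y)) = tensor_lift K (H r) (H r) T (\<lambda>x1 x2.
      tensor_lift K (H p) (H p) T (\<lambda>y1 y2. ?P x1 x2 y1 y2 s) (\<Delta> p y)) (\<Delta> r x)"
    if ss: "s \<in> carrier (H r)" "x \<in> carrier (H r)" "y \<in> carrier (H p)" for s x y
  proof -
    have "?G s (\<Delta> \<one>\<^bsub>Q\<^esub> (prd r p x y)) = ?G s (\<Delta> (r \<otimes>\<^bsub>Q\<^esub> p) (prd r p x y))"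
      by (simp add: r)
    also have "\<dots> = ?G s (tensor_lift K (H r) (H r) ?T1 (\<lambda>x1 x2. tensor_lift K (H p) (H p) ?T1
        (\<lambda>y1 y2. pure K (H \<one>\<^bsub>Q\<^esub>) (H \<one>\<^bsub>Q\<^esub>) (prd r p x1 y1) (prd r p x2 y2)) (\<Delta> p y)) (\<Delta> r x))"
      by (subst comult_prd) (simp_all add: s ss)
    also have "\<dots> = tensor_lift K (H r) (H r) T (\<lambda>x1 x2. ?G s (tensor_lift K (H p) (H p) ?T1
        (\<lambda>y1 y2. pure K (H \<one>\<^bsub>Q\<^esub>) (H \<one>\<^bsub>Q\<^esub>) (prd r p x1 y1) (prd r p x2 y2)) (\<Delta> p y))) (\<Delta> r x)"
      by (rule tensor_lift_comp[OF _ _ _ _ _ G]; (intro hopf_intros)?) (simp_all add: s ss)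
    also have "\<dots> = tensor_lift K (H r) (H r) T (\<lambda>x1 x2. tensor_lift K (H p) (H p) T
        (\<lambda>y1 y2. ?G s (pure K (H \<one>\<^bsub>Q\<^esub>) (H \<one>\<^bsub>Q\<^esub>) (prd r p x1 y1) (prd r p x2 y2))) (\<Delta> p y)) (\<Delta> r x)"
      by (rule tensor_lift_cong[OF refl refl refl refl],
          rule tensor_lift_comp[OF _ _ _ _ _ G]; (intro hopf_intros)?) (simp_all add: s ss)
    also have "\<dots> = tensor_lift K (H r) (H r) T (\<lambda>x1 x2.
        tensor_lift K (H p) (H p) T (\<lambda>y1 y2. ?P x1 x2 y1 y2 s) (\<Delta> p y)) (\<Delta> r x)"
      by (intro tensor_lift_cong refl tensor_lift_pure BG) (simp_all add: s ss)
    finally show ?thesis .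
  qed
  \<comment> \<open>The first evaluation, read backwards: the legs grouped as
    \<open>S(a1) a2\<close> collapse to \<open>\<epsilon>(a) 1\<close>, whose coproduct is
    \<open>\<epsilon>(a) (1 \<otimes> 1)\<close>.\<close>
  have "pure K (H \<one>\<^bsub>Q\<^esub>) (H r) ?e (S p h) = tensor_lift K ?HH ?HH T
      (\<lambda>a b. pure K (H \<one>\<^bsub>Q\<^esub>) (H r) ?e (S p (\<epsilon> p a \<odot>\<^bsub>?HH\<^esub> b))) (\<Delta> p h)"
    by (rule counit_left_lift[symmetric]; (unfold T_def, intro hopf_intros)?) (simp_all add: s)
  also have "\<dots> = tensor_lift K ?HH ?HH T (\<lambda>a b. tensor_lift K ?HH ?HH T
      (\<lambda>a1 a2. ?F a1 a2 b) (\<Delta> p a)) (\<Delta> p h)"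
  proof (rule tensor_lift_cong[OF refl refl refl refl])
    fix a b assume ab: "a \<in> carrier (H p)" "b \<in> carrier (H p)"
    have Sb: "S p b \<in> carrier (H r)" by (simp add: s ab)
    have "tensor_lift K ?HH ?HH T (\<lambda>a1 a2. ?F a1 a2 b) (\<Delta> p a) =
        tensor_lift K ?HH ?HH T (\<lambda>a1 a2. ?G (S p b) (\<Delta> \<one>\<^bsub>Q\<^esub> (prd r p (S p a1) a2))) (\<Delta> p a)"
      by (rule tensor_lift_cong[OF refl refl refl refl]) (simp add: Gprd s ab)
    also have "\<dots> = ?G (S p b) (\<Delta> \<one>\<^bsub>Q\<^esub> (tensor_lift K ?HH ?HH (H \<one>\<^bsub>Q\<^esub>) (\<lambda>a1 a2. prd r p (S p a1) a2) (\<Delta> p a)))"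
      by (rule tensor_lift_comp[OF _ _ _ _ _ GD[OF Sb], symmetric]; (intro hopf_intros)?)
        (simp_all add: s ab)
    also have "\<dots> = ?G (S p b) (\<Delta> \<one>\<^bsub>Q\<^esub> (\<epsilon> p a \<odot>\<^bsub>H \<one>\<^bsub>Q\<^esub>\<^esub> ?e))"
      using antipode_convolution[OF p ab(1)] by (simp add: r)
    also have "\<dots> = \<epsilon> p a \<odot>\<^bsub>T\<^esub> ?G (S p b) (pure K (H \<one>\<^bsub>Q\<^esub>) (H \<one>\<^bsub>Q\<^esub>) ?e ?e)"
      by (subst linear_mapsD(3)[OF GD[OF Sb]]) (simp_all add: s ab comult_unit)
    also have "\<dots> = \<epsilon> p a \<odot>\<^bsub>T\<^esub> pure K (H \<one>\<^bsub>Q\<^esub>) (H r) ?e (S p b)"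
      by (subst tensor_lift_pure[OF _ _ _ BG[OF Sb]]) (simp_all add: s ab Sb unit_left)
    also have "\<dots> = pure K (H \<one>\<^bsub>Q\<^esub>) (H r) ?e (S p (\<epsilon> p a \<odot>\<^bsub>?HH\<^esub> b))"
    proof -
      have "(\<lambda>b. pure K (H \<one>\<^bsub>Q\<^esub>) (H r) ?e (S p b)) \<in> linear_maps K ?HH T"
        by (unfold T_def, intro hopf_intros) (simp_all add: s)
      from linear_mapsD(3)[OF this, of "\<epsilon> p a" b] show ?thesis by (simp add: s ab)
    qed
    finally show "pure K (H \<one>\<^bsub>Q\<^esub>) (H r) ?e (S p (\<epsilon> p a \<odot>\<^bsub>?HH\<^esub> b)) =
      tensor_lift K ?HH ?HH T (\<lambda>a1 a2. ?F a1 a2 b) (\<Delta> p a)" by simp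
  qed
  \<comment> \<open>Regrouping separates the leg under the antipode from the other two, in
    preparation for the second evaluation.\<close>
  also have "\<dots> = tensor_lift K ?HH ?HH T (\<lambda>a b. tensor_lift K ?HH ?HH T
      (\<lambda>b1 b2. ?F a b1 b2) (\<Delta> p b)) (\<Delta> p h)"
    by (rule coassoc_lift; (unfold T_def, intro hopf_intros)?) (simp_all add: s)
  also have "\<dots> = tensor_lift K ?HH ?HH T (\<lambda>a b. tensor_lift K (H r) (H r) T
      (\<lambda>x1 x2. pure K (H \<one>\<^bsub>Q\<^esub>) (H r) (prd r p x1 b) x2) (\<Delta> r (S p a))) (\<Delta> p h)"
  proof (rule tensor_lift_cong[OF refl refl refl refl])
    fix a b assume ab: "a \<in> carrier (H p)" "b \<in> carrier (H p)"
    \<comment> \<open>The sum over \<open>\<Delta>(S(a))\<close> moves outside, so that all legs of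
      \<open>b\<close> stand together.\<close>
    have "tensor_lift K ?HH ?HH T (\<lambda>b1 b2. ?F a b1 b2) (\<Delta> p b) =
        tensor_lift K (H r) (H r) T (\<lambda>x1 x2. tensor_lift K ?HH ?HH T (\<lambda>b1 b2.
          tensor_lift K ?HH ?HH T (\<lambda>y1 y2. ?P x1 x2 y1 y2 (S p b2)) (\<Delta> p b1)) (\<Delta> p b)) (\<Delta> r (S p a))"
      by (rule tensor_lift_swap; (unfold T_def, intro hopf_intros)?) (simp_all add: s ab)
    also have "\<dots> = tensor_lift K (H r) (H r) T
        (\<lambda>x1 x2. pure K (H \<one>\<^bsub>Q\<^esub>) (H r) (prd r p x1 b) x2) (\<Delta> r (S p a))"
    proof (rule tensor_lift_cong[OF refl refl refl refl])
      fix x1 x2 assume x: "x1 \<in> carrier (H r)" "x2 \<in> carrier (H r)"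
      \<comment> \<open>After this regrouping \<open>y2\<close> and \<open>z\<close> are the two
        legs of one element \<open>c\<close>, and the factor \<open>(x2 y2) S(z)\<close> has exactly
        the bracketing of the second right antipode axiom.\<close>
      have "tensor_lift K ?HH ?HH T (\<lambda>b1 b2.
          tensor_lift K ?HH ?HH T (\<lambda>y1 y2. ?P x1 x2 y1 y2 (S p b2)) (\<Delta> p b1)) (\<Delta> p b) =
        tensor_lift K ?HH ?HH T (\<lambda>y1 c.
          tensor_lift K ?HH ?HH T (\<lambda>y2 z. ?P x1 x2 y1 y2 (S p z)) (\<Delta> p c)) (\<Delta> p b)"
        by (rule coassoc_lift; (unfold T_def, intro hopf_intros)?) (simp_all add: s ab x)
      also have "\<dots> = tensor_lift K ?HH ?HH T (\<lambda>y1 c. pure K (H \<one>\<^bsub>Q\<^esub>) (H r)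
          (prd r p x1 (\<epsilon> p c \<odot>\<^bsub>?HH\<^esub> y1)) x2) (\<Delta> p b)"
      proof (rule tensor_lift_cong[OF refl refl refl refl])
        fix y1 c assume yc: "y1 \<in> carrier (H p)" "c \<in> carrier (H p)"
        have L: "(\<lambda>x. pure K (H \<one>\<^bsub>Q\<^esub>) (H r) (prd r p x1 y1) x) \<in> linear_maps K (H r) T"
          by (unfold T_def, intro hopf_intros) (simp_all add: s ab x yc)
        have L': "(\<lambda>y. pure K (H \<one>\<^bsub>Q\<^esub>) (H r) (prd r p x1 y) x2) \<in> linear_maps K ?HH T"
          by (unfold T_def, intro hopf_intros) (simp_all add: s ab x yc)
        have "tensor_lift K ?HH ?HH T (\<lambda>y2 z. ?P x1 x2 y1 y2 (S p z)) (\<Delta> p c) =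
          pure K (H \<one>\<^bsub>Q\<^esub>) (H r) (prd r p x1 y1) (tensor_lift K ?HH ?HH (H r)
            (\<lambda>y2 z. prd \<one>\<^bsub>Q\<^esub> r (prd r p x2 y2) (S p z)) (\<Delta> p c))"
          by (rule tensor_lift_comp[OF _ _ _ _ _ L, symmetric]; (intro hopf_intros)?)
            (simp_all add: s ab x yc)
        also have "\<dots> = pure K (H \<one>\<^bsub>Q\<^esub>) (H r) (prd r p x1 y1) (\<epsilon> p c \<odot>\<^bsub>H r\<^esub> x2)"
          using antipode_right_2[OF p r(1) yc(2) x(2)] by (simp add: r)
        also have "\<dots> = \<epsilon> p c \<odot>\<^bsub>T\<^esub> pure K (H \<one>\<^bsub>Q\<^esub>) (H r) (prd r p x1 y1) x2"
          by (rule linear_mapsD(3)[OF L]) (simp_all add: s x yc)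
        also have "\<dots> = pure K (H \<one>\<^bsub>Q\<^esub>) (H r) (prd r p x1 (\<epsilon> p c \<odot>\<^bsub>?HH\<^esub> y1)) x2"
          by (rule linear_mapsD(3)[OF L', symmetric]) (simp_all add: s x yc)
        finally show "tensor_lift K ?HH ?HH T (\<lambda>y2 z. ?P x1 x2 y1 y2 (S p z)) (\<Delta> p c) =
          pure K (H \<one>\<^bsub>Q\<^esub>) (H r) (prd r p x1 (\<epsilon> p c \<odot>\<^bsub>?HH\<^esub> y1)) x2" .
      qed
      also have "\<dots> = pure K (H \<one>\<^bsub>Q\<^esub>) (H r) (prd r p x1 b) x2"
        by (rule counit_right_lift; (unfold T_def, intro hopf_intros)?) (simp_all add: s ab x)
      finally show "tensor_lift K ?HH ?HH T (\<lambda>b1 b2.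
          tensor_lift K ?HH ?HH T (\<lambda>y1 y2. ?P x1 x2 y1 y2 (S p b2)) (\<Delta> p b1)) (\<Delta> p b) =
        pure K (H \<one>\<^bsub>Q\<^esub>) (H r) (prd r p x1 b) x2" .
    qed
    finally show "tensor_lift K ?HH ?HH T (\<lambda>b1 b2. ?F a b1 b2) (\<Delta> p b) =
      tensor_lift K (H r) (H r) T
        (\<lambda>x1 x2. pure K (H \<one>\<^bsub>Q\<^esub>) (H r) (prd r p x1 b) x2) (\<Delta> r (S p a))" .
  qed
  finally show ?thesis by simp
qed

end

section \<open>The modified action\<close>

context graded_quasimodule
begin

lemma act_closed: "\<lbrakk>p \<in> carrier Q; q \<in> carrier Q; h \<in> carrier (H p); x \<in> carrier (M q);
    r = p \<otimes>\<^bsub>Q\<^esub> q\<rbrakk> \<Longrightarrow> act p q h x \<in> carrier (M r)"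
  using linear_mapsD(1)[OF action_linear] pure_closed[OF H_module component_module] by blast

lemma action_linear_comp: "\<lbrakk>p \<in> carrier Q; q \<in> carrier Q;
    g \<in> linear_maps K X (tensor K (H p) (M q)); r = p \<otimes>\<^bsub>Q\<^esub> q\<rbrakk> \<Longrightarrow>
    (\<lambda>x. \<phi> p q (g x)) \<in> linear_maps K X (M r)"
  using linear_maps_comp[OF action_linear] by auto

end

context graded_hopf_quasimodule
begin

lemma coact_lin: "q \<in> carrier Q \<Longrightarrow> \<rho> q \<in> linear_maps K (M q) (tensor K (H q) (M q))"
  by (rule left_comodule.coact_linear[OF component_comodule])

lemma coact_closed: "\<lbrakk>q \<in> carrier Q; x \<in> carrier (M q)\<rbrakk> \<Longrightarrow>
    \<rho> q x \<in> carrier (tensor K (H q) (M q))"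
  by (rule linear_mapsD(1)[OF coact_lin])

lemma coact_linear_comp: "\<lbrakk>q \<in> carrier Q; f \<in> linear_maps K X (M q)\<rbrakk> \<Longrightarrow>
    (\<lambda>x. \<rho> q (f x)) \<in> linear_maps K X (tensor K (H q) (M q))"
  by (rule linear_maps_comp[OF coact_lin])

lemmas quasi_intros = hopf_intros action_linear_comp coact_linear_comp
lemmas quasi_simps = hopf_simps component_module act_closed coact_closed

lemmas coact_coassoc_lift = left_comodule.coact_coassoc_lift[OF component_comodule]

section \<open>Coinvariants and the projection onto them\<close>

text \<open>The map \<open>\<pi>\<close> of the overview. All components project to the one at
  \<open>\<one>\<close>, since \<open>qinv Q q \<otimes> q = \<one>\<close>.\<close>

definition proj :: "'q \<Rightarrow> 'm \<Rightarrow> 'm" where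
  "proj q x = tensor_lift K (H q) (M q) (M \<one>\<^bsub>Q\<^esub>) (\<lambda>a y. act (qinv Q q) q (S q a) y) (\<rho> q x)"

text \<open>Restricted to the component at \<open>\<one>\<close> because the unit of
  \<open>H\<close> lies in \<open>H \<one>\<close>.\<close>

definition coinvariant :: "'m \<Rightarrow> bool" where
  "coinvariant w \<longleftrightarrow> w \<in> carrier (M \<one>\<^bsub>Q\<^esub>) \<and>
     \<rho> \<one>\<^bsub>Q\<^esub> w = pure K (H \<one>\<^bsub>Q\<^esub>) (M \<one>\<^bsub>Q\<^esub>) (\<mu> \<one>\<^bsub>K\<^esub>) w"

lemma proj_bilinear:
  assumes "q \<in> carrier Q"
  shows "(\<lambda>a y. act (qinv Q q) q (S q a) y) \<in> bilinear_maps K (H q) (M q) (M \<one>\<^bsub>Q\<^esub>)"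
  by (intro quasi_intros) (simp_all add: assms quasi_simps)

lemma proj_linear_comp: "\<lbrakk>q \<in> carrier Q; f \<in> linear_maps K X (M q)\<rbrakk> \<Longrightarrow>
    (\<lambda>x. proj q (f x)) \<in> linear_maps K X (M \<one>\<^bsub>Q\<^esub>)"
  unfolding proj_def
  by (intro tensor_lift_linear_arg proj_bilinear coact_linear_comp) (simp_all add: quasi_simps)

lemma proj_closed: "\<lbrakk>q \<in> carrier Q; x \<in> carrier (M q)\<rbrakk> \<Longrightarrow> proj q x \<in> carrier (M \<one>\<^bsub>Q\<^esub>)"
  using linear_mapsD(1)[OF proj_linear_comp[OF _ linear_maps_id]] .

text \<open>Compatibility of coaction and action gives legs of the form
  \<open>S(a)\<^sub>1 b \<otimes> S(a)\<^sub>2 \<cdot> z\<close> with \<open>a\<close>,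
  \<open>b\<close>, \<open>z\<close> the iterated coaction of \<open>x\<close>. Coassociativity
  makes \<open>a\<close> and \<open>b\<close> two legs of one element, and
  \<open>antipode_comult\<close> applies.\<close>

lemma proj_coinvariant:
  assumes q: "q \<in> carrier Q" and x: "x \<in> carrier (M q)"
  shows "coinvariant (proj q x)"
proof -
  define r where "r = qinv Q q"
  define T where "T = tensor K (H \<one>\<^bsub>Q\<^esub>) (M \<one>\<^bsub>Q\<^esub>)"
  have r: "r \<in> carrier Q" "r \<otimes>\<^bsub>Q\<^esub> q = \<one>\<^bsub>Q\<^esub>" "q \<otimes>\<^bsub>Q\<^esub> r = \<one>\<^bsub>Q\<^esub>" "qinv Q r = q" "qinv Q q = r"
    using q by (simp_all add: r_def index_simps)
  have mT: "module K T" by (simp add: T_def quasi_simps)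
  note s = q r mT quasi_simps
  let ?e = "\<mu> \<one>\<^bsub>K\<^esub>"
  let ?E = "\<lambda>b z c d. pure K (H \<one>\<^bsub>Q\<^esub>) (M \<one>\<^bsub>Q\<^esub>) (prd r q c b) (act r q d z)"
  let ?F = "\<lambda>a b z. tensor_lift K (H r) (H r) T (?E b z) (\<Delta> r (S q a))"
  let ?J = "\<lambda>y. tensor_lift K (H \<one>\<^bsub>Q\<^esub>) (H r) T (\<lambda>u v. pure K (H \<one>\<^bsub>Q\<^esub>) (M \<one>\<^bsub>Q\<^esub>) u (act r q v y))"
  have "\<rho> \<one>\<^bsub>Q\<^esub> (proj q x) = tensor_lift K (H q) (M q) T (\<lambda>a y. \<rho> \<one>\<^bsub>Q\<^esub> (act r q (S q a) y)) (\<rho> q x)"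
    unfolding proj_def r(5) T_def
    by (rule tensor_lift_comp[OF _ _ _ _ _ coact_lin]; (intro quasi_intros)?) (simp_all add: s x)
  also have "\<dots> = tensor_lift K (H q) (M q) T (\<lambda>a y.
      tensor_lift K (H q) (M q) T (\<lambda>b z. ?F a b z) (\<rho> q y)) (\<rho> q x)"
  proof (rule tensor_lift_cong[OF refl refl refl refl])
    fix a y assume ay: "a \<in> carrier (H q)" "y \<in> carrier (M q)"
    have "\<rho> \<one>\<^bsub>Q\<^esub> (act r q (S q a) y) = tensor_lift K (H r) (H r) T (\<lambda>c d.
        tensor_lift K (H q) (M q) T (\<lambda>b z. ?E b z c d) (\<rho> q y)) (\<Delta> r (S q a))"
      using coaction_action[OF r(1) q _ ay(2), of "S q a"] by (simp add: s ay Let_def T_def)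
    \<comment> \<open>The coaction of \<open>y\<close> has to be the outer sum here for
      coassociativity to match.\<close>
    also have "\<dots> = tensor_lift K (H q) (M q) T (\<lambda>b z. ?F a b z) (\<rho> q y)"
      by (rule tensor_lift_swap; (unfold T_def, intro quasi_intros)?) (simp_all add: s ay)
    finally show "\<rho> \<one>\<^bsub>Q\<^esub> (act r q (S q a) y) =
      tensor_lift K (H q) (M q) T (\<lambda>b z. ?F a b z) (\<rho> q y)" .
  qed
  also have "\<dots> = tensor_lift K (H q) (M q) T (\<lambda>a y.
      tensor_lift K (H q) (H q) T (\<lambda>a1 a2. ?F a1 a2 y) (\<Delta> q a)) (\<rho> q x)"
    by (rule coact_coassoc_lift[symmetric]; (unfold T_def, intro quasi_intros)?) (simp_all add: s x)
  also have "\<dots> = tensor_lift K (H q) (M q) T (\<lambda>a y.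
      pure K (H \<one>\<^bsub>Q\<^esub>) (M \<one>\<^bsub>Q\<^esub>) ?e (act r q (S q a) y)) (\<rho> q x)"
  proof (rule tensor_lift_cong[OF refl refl refl refl])
    fix a y assume ay: "a \<in> carrier (H q)" "y \<in> carrier (M q)"
    let ?T' = "tensor K (H \<one>\<^bsub>Q\<^esub>) (H r)"
    have BJ: "(\<lambda>u v. pure K (H \<one>\<^bsub>Q\<^esub>) (M \<one>\<^bsub>Q\<^esub>) u (act r q v y)) \<in> bilinear_maps K (H \<one>\<^bsub>Q\<^esub>) (H r) T"
      by (unfold T_def, intro quasi_intros) (simp_all add: s ay)
    have J: "?J y \<in> linear_maps K ?T' T"
      by (rule tensor_lift_linear[OF _ _ _ BJ]) (simp_all add: s)
    \<comment> \<open>\<open>?J y\<close> is the linear map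
      \<open>u \<otimes> v \<mapsto> u \<otimes> v \<cdot> y\<close>. Factoring it out leaves an
      expression in \<open>H\<close> alone, namely the left side of
      \<open>antipode_comult\<close>.\<close>
    have "tensor_lift K (H q) (H q) T (\<lambda>a1 a2. ?F a1 a2 y) (\<Delta> q a) =
        tensor_lift K (H q) (H q) T (\<lambda>a1 a2. tensor_lift K (H r) (H r) T
          (\<lambda>c d. ?J y (pure K (H \<one>\<^bsub>Q\<^esub>) (H r) (prd r q c a2) d)) (\<Delta> r (S q a1))) (\<Delta> q a)"
      by (intro tensor_lift_cong refl, subst tensor_lift_pure[OF _ _ _ BJ]) (simp_all add: s)
    also have "\<dots> = tensor_lift K (H q) (H q) T (\<lambda>a1 a2. ?J y (tensor_lift K (H r) (H r) ?T'
          (\<lambda>c d. pure K (H \<one>\<^bsub>Q\<^esub>) (H r) (prd r q c a2) d) (\<Delta> r (S q a1)))) (\<Delta> q a)"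
      by (rule tensor_lift_cong[OF refl refl refl refl],
          rule tensor_lift_comp[OF _ _ _ _ _ J, symmetric]; (intro quasi_intros)?) (simp_all add: s)
    also have "\<dots> = ?J y (tensor_lift K (H q) (H q) ?T' (\<lambda>a1 a2. tensor_lift K (H r) (H r) ?T'
          (\<lambda>c d. pure K (H \<one>\<^bsub>Q\<^esub>) (H r) (prd r q c a2) d) (\<Delta> r (S q a1))) (\<Delta> q a))"
      by (rule tensor_lift_comp[OF _ _ _ _ _ J, symmetric]; (intro quasi_intros)?) (simp_all add: s ay)
    also have "\<dots> = ?J y (pure K (H \<one>\<^bsub>Q\<^esub>) (H r) ?e (S q a))"
      using antipode_comult[OF q ay(1)] by (simp add: r)
    also have "\<dots> = pure K (H \<one>\<^bsub>Q\<^esub>) (M \<one>\<^bsub>Q\<^esub>) ?e (act r q (S q a) y)"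
      by (rule tensor_lift_pure[OF _ _ _ BJ]) (simp_all add: s ay)
    finally show "tensor_lift K (H q) (H q) T (\<lambda>a1 a2. ?F a1 a2 y) (\<Delta> q a) =
      pure K (H \<one>\<^bsub>Q\<^esub>) (M \<one>\<^bsub>Q\<^esub>) ?e (act r q (S q a) y)" .
  qed
  also have "\<dots> = pure K (H \<one>\<^bsub>Q\<^esub>) (M \<one>\<^bsub>Q\<^esub>) ?e (proj q x)"
    unfolding proj_def r(5) T_def
    by (rule tensor_lift_comp[symmetric]; (intro quasi_intros)?) (simp_all add: s x)
  finally show ?thesis by (simp add: coinvariant_def proj_closed q x)
qed

text \<open>Coassociativity turns the summand into \<open>a1 \<cdot> (S(a2) \<cdot> y)\<close>, the
  antipode axiom of the action reduces it to \<open>\<epsilon>(a) y\<close>, and the counit law of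
  the coaction finishes.\<close>

lemma coaction_decomposition:
  assumes q: "q \<in> carrier Q" and x: "x \<in> carrier (M q)"
  shows "tensor_lift K (H q) (M q) (M q) (\<lambda>a y. act q \<one>\<^bsub>Q\<^esub> a (proj q y)) (\<rho> q x) = x"
proof -
  let ?r = "qinv Q q"
  note s = q x quasi_simps
  have "tensor_lift K (H q) (M q) (M q) (\<lambda>a y. act q \<one>\<^bsub>Q\<^esub> a (proj q y)) (\<rho> q x) =
      tensor_lift K (H q) (M q) (M q) (\<lambda>a y. tensor_lift K (H q) (M q) (M q)
        (\<lambda>b z. act q \<one>\<^bsub>Q\<^esub> a (act ?r q (S q b) z)) (\<rho> q y)) (\<rho> q x)"
    unfolding proj_def
    by (rule tensor_lift_cong[OF refl refl refl refl], rule tensor_lift_comp; (intro quasi_intros)?)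
      (simp_all add: s)
  also have "\<dots> = tensor_lift K (H q) (M q) (M q) (\<lambda>a y. tensor_lift K (H q) (H q) (M q)
        (\<lambda>a1 a2. act q \<one>\<^bsub>Q\<^esub> a1 (act ?r q (S q a2) y)) (\<Delta> q a)) (\<rho> q x)"
    by (rule coact_coassoc_lift[symmetric]; (intro quasi_intros)?) (simp_all add: s)
  also have "\<dots> = tensor_lift K (H q) (M q) (M q) (\<lambda>a y. \<epsilon> q a \<odot>\<^bsub>M q\<^esub> y) (\<rho> q x)"
    by (rule tensor_lift_cong) (use action_antipode_1[OF q q] in \<open>simp_all add: s\<close>)
  also have "\<dots> = x"
    by (rule left_comodule.coact_counit[OF component_comodule[OF q] x])
  finally show ?thesis .
qed

section \<open>Testing linear identities on translates of coinvariants\<close>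

text \<open>By \<open>coaction_decomposition\<close> and \<open>proj_coinvariant\<close>,
  \<open>x\<close> is a sum of elements \<open>a \<cdot> w\<close> with \<open>w\<close>
  coinvariant, and linear maps commute with that sum.\<close>

lemma coinvariant_span:
  assumes q: "q \<in> carrier Q" and x: "x \<in> carrier (M q)" and U: "module K U"
    and f: "f \<in> linear_maps K (M q) U" and g: "g \<in> linear_maps K (M q) U"
    and fg: "\<And>a w. \<lbrakk>a \<in> carrier (H q); coinvariant w\<rbrakk> \<Longrightarrow>
      f (act q \<one>\<^bsub>Q\<^esub> a w) = g (act q \<one>\<^bsub>Q\<^esub> a w)"
  shows "f x = g x"
proof -
  let ?D = "\<lambda>a y. act q \<one>\<^bsub>Q\<^esub> a (proj q y)"
  note s = q x U quasi_simps proj_closed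
  have B: "?D \<in> bilinear_maps K (H q) (M q) (M q)"
    by (intro quasi_intros proj_linear_comp) (simp_all add: s)
  have "f x = tensor_lift K (H q) (M q) U (\<lambda>a y. f (?D a y)) (\<rho> q x)"
    using tensor_lift_comp[OF _ _ _ U B f, of "\<rho> q x"] by (simp add: s coaction_decomposition)
  also have "\<dots> = tensor_lift K (H q) (M q) U (\<lambda>a y. g (?D a y)) (\<rho> q x)"
    by (rule tensor_lift_cong) (simp_all add: fg q proj_coinvariant)
  also have "\<dots> = g x"
    using tensor_lift_comp[OF _ _ _ U B g, of "\<rho> q x"] by (simp add: s coaction_decomposition)
  finally show ?thesis .
qed

text \<open>The coaction of \<open>w\<close> contributes only the unit of \<open>H\<close>, which
  the right unit law then removes from the first leg.\<close>

lemma coaction_coinvariant: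
  assumes q: "q \<in> carrier Q" and a: "a \<in> carrier (H q)" and w: "coinvariant w"
  shows "\<rho> q (act q \<one>\<^bsub>Q\<^esub> a w) = tensor_lift K (H q) (H q) (tensor K (H q) (M q))
    (\<lambda>a1 a2. pure K (H q) (M q) a1 (act q \<one>\<^bsub>Q\<^esub> a2 w)) (\<Delta> q a)"
proof -
  let ?T = "tensor K (H q) (M q)"
  have w': "w \<in> carrier (M \<one>\<^bsub>Q\<^esub>)" "\<rho> \<one>\<^bsub>Q\<^esub> w = pure K (H \<one>\<^bsub>Q\<^esub>) (M \<one>\<^bsub>Q\<^esub>) (\<mu> \<one>\<^bsub>K\<^esub>) w"
    using w by (auto simp: coinvariant_def)
  note s = q a w'(1) quasi_simps
  have "\<rho> q (act q \<one>\<^bsub>Q\<^esub> a w) = tensor_lift K (H q) (H q) ?T (\<lambda>a1 a2. tensor_lift K (H \<one>\<^bsub>Q\<^esub>) (M \<one>\<^bsub>Q\<^esub>) ?T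
      (\<lambda>c y. pure K (H q) (M q) (prd q \<one>\<^bsub>Q\<^esub> a1 c) (act q \<one>\<^bsub>Q\<^esub> a2 y))
        (pure K (H \<one>\<^bsub>Q\<^esub>) (M \<one>\<^bsub>Q\<^esub>) (\<mu> \<one>\<^bsub>K\<^esub>) w)) (\<Delta> q a)"
    using coaction_action[OF q _ a w'(1)] by (simp add: s Let_def w'(2))
  also have "\<dots> = tensor_lift K (H q) (H q) ?T
      (\<lambda>a1 a2. pure K (H q) (M q) (prd q \<one>\<^bsub>Q\<^esub> a1 (\<mu> \<one>\<^bsub>K\<^esub>)) (act q \<one>\<^bsub>Q\<^esub> a2 w)) (\<Delta> q a)"
    by (rule tensor_lift_cong[OF refl refl refl refl], rule tensor_lift_pure; (intro quasi_intros)?)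
      (simp_all add: s)
  also have "\<dots> = tensor_lift K (H q) (H q) ?T
      (\<lambda>a1 a2. pure K (H q) (M q) a1 (act q \<one>\<^bsub>Q\<^esub> a2 w)) (\<Delta> q a)"
    by (rule tensor_lift_cong) (simp_all add: unit_right q)
  finally show ?thesis .
qed

lemma coaction_coinvariant_lift:
  assumes q: "q \<in> carrier Q" and a: "a \<in> carrier (H q)" and w: "coinvariant w"
    and U: "module K U" and B: "B \<in> bilinear_maps K (H q) (M q) U"
  shows "tensor_lift K (H q) (M q) U B (\<rho> q (act q \<one>\<^bsub>Q\<^esub> a w)) =
    tensor_lift K (H q) (H q) U (\<lambda>a1 a2. B a1 (act q \<one>\<^bsub>Q\<^esub> a2 w)) (\<Delta> q a)"
proof -
  have w': "w \<in> carrier (M \<one>\<^bsub>Q\<^esub>)" using w by (auto simp: coinvariant_def)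
  note s = q a w' U quasi_simps
  have L: "tensor_lift K (H q) (M q) U B \<in> linear_maps K (tensor K (H q) (M q)) U"
    by (rule tensor_lift_linear[OF _ _ _ B]) (simp_all add: s)
  have "tensor_lift K (H q) (M q) U B (\<rho> q (act q \<one>\<^bsub>Q\<^esub> a w)) =
      tensor_lift K (H q) (H q) U (\<lambda>a1 a2. tensor_lift K (H q) (M q) U B
        (pure K (H q) (M q) a1 (act q \<one>\<^bsub>Q\<^esub> a2 w))) (\<Delta> q a)"
    unfolding coaction_coinvariant[OF q a w]
    by (rule tensor_lift_comp[OF _ _ _ _ _ L]; (intro quasi_intros)?) (simp_all add: s)
  also have "\<dots> = tensor_lift K (H q) (H q) U (\<lambda>a1 a2. B a1 (act q \<one>\<^bsub>Q\<^esub> a2 w)) (\<Delta> q a)"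
    by (rule tensor_lift_cong[OF refl refl refl refl], rule tensor_lift_pure[OF _ _ _ B])
      (simp_all add: s)
  finally show ?thesis .
qed

text \<open>By the coaction formula the projection becomes
  \<open>S(a1) \<cdot> (a2 \<cdot> w)\<close>, the left side of the second antipode axiom of the
  action.\<close>

lemma proj_action_coinvariant:
  assumes q: "q \<in> carrier Q" and a: "a \<in> carrier (H q)" and w: "coinvariant w"
  shows "proj q (act q \<one>\<^bsub>Q\<^esub> a w) = \<epsilon> q a \<odot>\<^bsub>M \<one>\<^bsub>Q\<^esub>\<^esub> w"
proof -
  have w': "w \<in> carrier (M \<one>\<^bsub>Q\<^esub>)" using w by (auto simp: coinvariant_def)
  have "proj q (act q \<one>\<^bsub>Q\<^esub> a w) = tensor_lift K (H q) (H q) (M \<one>\<^bsub>Q\<^esub>)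
      (\<lambda>a1 a2. act (qinv Q q) q (S q a1) (act q \<one>\<^bsub>Q\<^esub> a2 w)) (\<Delta> q a)"
    unfolding proj_def
    by (rule coaction_coinvariant_lift[OF q a w _ proj_bilinear[OF q]]) (simp add: quasi_simps)
  also have "\<dots> = \<epsilon> q a \<odot>\<^bsub>M \<one>\<^bsub>Q\<^esub>\<^esub> w"
    using action_antipode_2[OF q _ a w'] by (simp add: q quasi_simps)
  finally show ?thesis .
qed

section \<open>Evaluating the modified action\<close>

lemma modified_action_bilinear:
  assumes p: "p \<in> carrier Q" and q: "q \<in> carrier Q"
  shows "(\<lambda>h x. tensor_lift K (tensor K (H q) (H q)) (M q) (M (p \<otimes>\<^bsub>Q\<^esub> q)) (\<lambda>t x0.
       tensor_lift K (H q) (H q) (M (p \<otimes>\<^bsub>Q\<^esub> q)) (\<lambda>a b.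
         act (p \<otimes>\<^bsub>Q\<^esub> q) (qinv Q q \<otimes>\<^bsub>Q\<^esub> q) (prd p q h a) (act (qinv Q q) q (S q b) x0)) t)
       (tensor_map K (H q) (M q) (tensor K (H q) (H q)) (M q) (\<Delta> q) id (\<rho> q x)))
    \<in> bilinear_maps K (H p) (M q) (M (p \<otimes>\<^bsub>Q\<^esub> q))"
proof -
  have id: "id \<in> linear_maps K (M q) (M q)" unfolding id_def by (rule linear_maps_id)
  show ?thesis
    by (intro quasi_intros tensor_map_linear_arg tensor_map_closed)
      (simp_all add: p q quasi_simps comult_lin id)
qed

lemma modified_action_linear:
  assumes "p \<in> carrier Q" "q \<in> carrier Q"
  shows "modified_action p q \<in> linear_maps K (tensor K (H p) (M q)) (M (p \<otimes>\<^bsub>Q\<^esub> q))"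
  unfolding modified_action_def Let_def
  by (rule tensor_lift_linear[OF _ _ _ modified_action_bilinear[OF assms]])
    (simp_all add: assms quasi_simps)

lemma modified_action_linear_comp:
  "\<lbrakk>p \<in> carrier Q; q \<in> carrier Q; g \<in> linear_maps K X (tensor K (H p) (M q)); r = p \<otimes>\<^bsub>Q\<^esub> q\<rbrakk> \<Longrightarrow>
    (\<lambda>x. modified_action p q (g x)) \<in> linear_maps K X (M r)"
  using linear_maps_comp[OF modified_action_linear] by blast

lemma modified_action_closed:
  "\<lbrakk>p \<in> carrier Q; q \<in> carrier Q; h \<in> carrier (H p); x \<in> carrier (M q); r = p \<otimes>\<^bsub>Q\<^esub> q\<rbrakk> \<Longrightarrow>
    modified_action p q (pure K (H p) (M q) h x) \<in> carrier (M r)"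
  using linear_mapsD(1)[OF modified_action_linear] by (simp add: quasi_simps)

text \<open>The definition takes the third leg from the coproduct of the first. Taking it from a
  second coaction instead makes the inner sum a projection, by linearity of the action.\<close>

lemma modified_action_pure:
  assumes p: "p \<in> carrier Q" and q: "q \<in> carrier Q"
    and h: "h \<in> carrier (H p)" and x: "x \<in> carrier (M q)"
  shows "modified_action p q (pure K (H p) (M q) h x) =
    tensor_lift K (H q) (M q) (M (p \<otimes>\<^bsub>Q\<^esub> q))
      (\<lambda>a y. act (p \<otimes>\<^bsub>Q\<^esub> q) \<one>\<^bsub>Q\<^esub> (prd p q h a) (proj q y)) (\<rho> q x)"
proof -
  let ?U = "M (p \<otimes>\<^bsub>Q\<^esub> q)" and ?HH = "tensor K (H q) (H q)"
  let ?A = "\<lambda>a b y. act (p \<otimes>\<^bsub>Q\<^esub> q) \<one>\<^bsub>Q\<^esub> (prd p q h a) (act (qinv Q q) q (S q b) y)"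
  note s = p q h x quasi_simps
  have id: "id \<in> linear_maps K (M q) (M q)" unfolding id_def by (rule linear_maps_id)
  have "modified_action p q (pure K (H p) (M q) h x) =
      tensor_lift K ?HH (M q) ?U (\<lambda>t x0. tensor_lift K (H q) (H q) ?U (\<lambda>a b. ?A a b x0) t)
        (tensor_map K (H q) (M q) ?HH (M q) (\<Delta> q) id (\<rho> q x))"
    unfolding modified_action_def Let_def
    by (subst tensor_lift_pure[OF _ _ _ modified_action_bilinear[OF p q]]) (simp_all add: s)
  also have "\<dots> = tensor_lift K (H q) (M q) ?U
      (\<lambda>a y. tensor_lift K (H q) (H q) ?U (\<lambda>a1 a2. ?A a1 a2 (id y)) (\<Delta> q a)) (\<rho> q x)"
    by (rule tensor_map_lift[OF _ _ _ _ _ comult_lin[OF q] id]; (intro quasi_intros)?)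
      (simp_all add: s)
  also have "\<dots> = tensor_lift K (H q) (M q) ?U
      (\<lambda>a y. tensor_lift K (H q) (M q) ?U (\<lambda>b z. ?A a b z) (\<rho> q y)) (\<rho> q x)"
    unfolding id_apply
    by (rule coact_coassoc_lift; (intro quasi_intros)?) (simp_all add: s)
  also have "\<dots> = tensor_lift K (H q) (M q) ?U
      (\<lambda>a y. act (p \<otimes>\<^bsub>Q\<^esub> q) \<one>\<^bsub>Q\<^esub> (prd p q h a) (proj q y)) (\<rho> q x)"
    unfolding proj_def
    by (rule tensor_lift_cong[OF refl refl refl refl],
        rule tensor_lift_comp[symmetric]; (intro quasi_intros)?) (simp_all add: s)
  finally show ?thesis .
qed

lemma modified_action_coinvariant:
  assumes p: "p \<in> carrier Q" and q: "q \<in> carrier Q"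
    and h: "h \<in> carrier (H p)" and a: "a \<in> carrier (H q)" and w: "coinvariant w"
  shows "modified_action p q (pure K (H p) (M q) h (act q \<one>\<^bsub>Q\<^esub> a w)) =
    act (p \<otimes>\<^bsub>Q\<^esub> q) \<one>\<^bsub>Q\<^esub> (prd p q h a) w"
proof -
  let ?U = "M (p \<otimes>\<^bsub>Q\<^esub> q)"
  have w': "w \<in> carrier (M \<one>\<^bsub>Q\<^esub>)" using w by (auto simp: coinvariant_def)
  note s = p q h a w' quasi_simps proj_closed
  have L: "(\<lambda>a. act (p \<otimes>\<^bsub>Q\<^esub> q) \<one>\<^bsub>Q\<^esub> (prd p q h a) w) \<in> linear_maps K (H q) ?U"
    by (intro quasi_intros) (simp_all add: s)
  have "modified_action p q (pure K (H p) (M q) h (act q \<one>\<^bsub>Q\<^esub> a w)) =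
      tensor_lift K (H q) (M q) ?U (\<lambda>a y. act (p \<otimes>\<^bsub>Q\<^esub> q) \<one>\<^bsub>Q\<^esub> (prd p q h a) (proj q y))
        (\<rho> q (act q \<one>\<^bsub>Q\<^esub> a w))"
    by (rule modified_action_pure) (simp_all add: s)
  also have "\<dots> = tensor_lift K (H q) (H q) ?U
      (\<lambda>a1 a2. act (p \<otimes>\<^bsub>Q\<^esub> q) \<one>\<^bsub>Q\<^esub> (prd p q h a1) (proj q (act q \<one>\<^bsub>Q\<^esub> a2 w))) (\<Delta> q a)"
    by (rule coaction_coinvariant_lift[OF q a w]; (intro quasi_intros proj_linear_comp)?)
      (simp_all add: s)
  also have "\<dots> = tensor_lift K (H q) (H q) ?U
      (\<lambda>a1 a2. act (p \<otimes>\<^bsub>Q\<^esub> q) \<one>\<^bsub>Q\<^esub> (prd p q h (\<epsilon> q a2 \<odot>\<^bsub>H q\<^esub> a1)) w) (\<Delta> q a)"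
  proof (rule tensor_lift_cong[OF refl refl refl refl])
    fix a1 a2 assume aa: "a1 \<in> carrier (H q)" "a2 \<in> carrier (H q)"
    have L': "(\<lambda>w. act (p \<otimes>\<^bsub>Q\<^esub> q) \<one>\<^bsub>Q\<^esub> (prd p q h a1) w) \<in> linear_maps K (M \<one>\<^bsub>Q\<^esub>) ?U"
      by (intro quasi_intros) (simp_all add: s aa)
    \<comment> \<open>The scalar \<open>\<epsilon>(a2)\<close> produced by the projection is carried
      from \<open>w\<close> over to \<open>a1\<close>, where the counit law can use it.\<close>
    show "act (p \<otimes>\<^bsub>Q\<^esub> q) \<one>\<^bsub>Q\<^esub> (prd p q h a1) (proj q (act q \<one>\<^bsub>Q\<^esub> a2 w)) =
        act (p \<otimes>\<^bsub>Q\<^esub> q) \<one>\<^bsub>Q\<^esub> (prd p q h (\<epsilon> q a2 \<odot>\<^bsub>H q\<^esub> a1)) w"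
      using linear_mapsD(3)[OF L, of "\<epsilon> q a2" a1] linear_mapsD(3)[OF L', of "\<epsilon> q a2" w]
      by (simp add: s aa proj_action_coinvariant w)
  qed
  also have "\<dots> = act (p \<otimes>\<^bsub>Q\<^esub> q) \<one>\<^bsub>Q\<^esub> (prd p q h a) w"
    by (rule counit_right_lift[OF q a _ L]) (simp add: s)
  finally show ?thesis .
qed

section \<open>The axioms for the modified action\<close>

text \<open>Components and coactions are unchanged, so the comodule laws carry over. The unit,
  antipode and compatibility laws are linear in \<open>x\<close> and are tested on
  \<open>a \<cdot> w\<close>.\<close>

lemma modified_action_hopf_quasimodule:
  "graded_hopf_quasimodule Q K H m \<mu> \<Delta> \<epsilon> S M modified_action \<rho>"
proof (intro graded_hopf_quasimodule.intro graded_quasimodule.intro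
    graded_hopf_quasimodule_axioms.intro graded_quasimodule_axioms.intro)
  note s = quasi_simps modified_action_closed
  show "graded_hopf_quasigroup Q K H m \<mu> \<Delta> \<epsilon> S" by (rule graded_hopf_quasigroup_axioms)
  show "module K (M q)" if "q \<in> carrier Q" for q using that by (rule component_module)
  show "modified_action p q \<in> linear_maps K (tensor K (H p) (M q)) (M (p \<otimes>\<^bsub>Q\<^esub> q))"
    if "p \<in> carrier Q" "q \<in> carrier Q" for p q using that by (rule modified_action_linear)
  show "left_comodule K (H q) (\<Delta> q) (\<epsilon> q) (M q) (\<rho> q)" if "q \<in> carrier Q" for q
    using that by (rule component_comodule)
  show "modified_action \<one>\<^bsub>Q\<^esub> q (pure K (H \<one>\<^bsub>Q\<^esub>) (M q) (\<mu> \<one>\<^bsub>K\<^esub>) x) = x"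
    if q: "q \<in> carrier Q" and x: "x \<in> carrier (M q)" for q x
  proof (rule coinvariant_span[OF q x component_module[OF q]])
    show "(\<lambda>x. modified_action \<one>\<^bsub>Q\<^esub> q (pure K (H \<one>\<^bsub>Q\<^esub>) (M q) (\<mu> \<one>\<^bsub>K\<^esub>) x)) \<in> linear_maps K (M q) (M q)"
      by (intro quasi_intros modified_action_linear_comp) (simp_all add: q s)
    show "(\<lambda>x. x) \<in> linear_maps K (M q) (M q)" by (rule linear_maps_id)
    show "modified_action \<one>\<^bsub>Q\<^esub> q (pure K (H \<one>\<^bsub>Q\<^esub>) (M q) (\<mu> \<one>\<^bsub>K\<^esub>) (act q \<one>\<^bsub>Q\<^esub> a w)) = act q \<one>\<^bsub>Q\<^esub> a w"
      if "a \<in> carrier (H q)" "coinvariant w" for a w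
      using that by (simp add: modified_action_coinvariant s q unit_left)
  qed
  fix p q h x assume p: "p \<in> carrier Q" and q: "q \<in> carrier Q"
    and h: "h \<in> carrier (H p)" and x: "x \<in> carrier (M q)"
  let ?r = "qinv Q p"
  let ?m = "\<lambda>p q h x. modified_action p q (pure K (H p) (M q) h x)"
  note s = s p q h
  have R: "(\<lambda>x. \<epsilon> p h \<odot>\<^bsub>M q\<^esub> x) \<in> linear_maps K (M q) (M q)"
    by (intro quasi_intros) (simp_all add: s)
  \<comment> \<open>Linearity in \<open>a\<close> for a fixed \<open>w\<close> lets the Sweedler sum
    over \<open>h\<close> be carried out inside \<open>H\<close> before acting on
    \<open>w\<close>.\<close>
  have AL: "(\<lambda>a. act q \<one>\<^bsub>Q\<^esub> a w) \<in> linear_maps K (H q) (M q)" if "coinvariant w" for w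
    by (intro quasi_intros) (use that in \<open>simp_all add: s coinvariant_def\<close>)
  show "tensor_lift K (H p) (H p) (M q)
      (\<lambda>a b. ?m p (?r \<otimes>\<^bsub>Q\<^esub> q) a (?m ?r q (S p b) x)) (\<Delta> p h) = \<epsilon> p h \<odot>\<^bsub>M q\<^esub> x"
  proof (rule coinvariant_span[OF q x component_module[OF q] _ R])
    show "(\<lambda>x. tensor_lift K (H p) (H p) (M q)
        (\<lambda>a b. ?m p (?r \<otimes>\<^bsub>Q\<^esub> q) a (?m ?r q (S p b) x)) (\<Delta> p h)) \<in> linear_maps K (M q) (M q)"
      by (intro quasi_intros modified_action_linear_comp) (simp_all add: s)
    fix c w assume c: "c \<in> carrier (H q)" and w: "coinvariant w"
    \<comment> \<open>The inner modified action yields \<open>(S(b) c) \<cdot> w\<close>, again a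
      translate of \<open>w\<close>, so the outer one multiplies from the left. The bracketing is
      that of the second left antipode axiom.\<close>
    have "tensor_lift K (H p) (H p) (M q)
        (\<lambda>a b. ?m p (?r \<otimes>\<^bsub>Q\<^esub> q) a (?m ?r q (S p b) (act q \<one>\<^bsub>Q\<^esub> c w))) (\<Delta> p h) =
      tensor_lift K (H p) (H p) (M q)
        (\<lambda>a b. act q \<one>\<^bsub>Q\<^esub> (prd p (?r \<otimes>\<^bsub>Q\<^esub> q) a (prd ?r q (S p b) c)) w) (\<Delta> p h)"
      by (rule tensor_lift_cong) (simp_all add: s c w modified_action_coinvariant)
    also have "\<dots> = act q \<one>\<^bsub>Q\<^esub> (tensor_lift K (H p) (H p) (H q)
        (\<lambda>a b. prd p (?r \<otimes>\<^bsub>Q\<^esub> q) a (prd ?r q (S p b) c)) (\<Delta> p h)) w"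
      by (rule tensor_lift_comp[OF _ _ _ _ _ AL[OF w], symmetric]; (intro quasi_intros)?)
        (simp_all add: s c)
    also have "\<dots> = \<epsilon> p h \<odot>\<^bsub>M q\<^esub> act q \<one>\<^bsub>Q\<^esub> c w"
      unfolding antipode_left_2[OF p q h c]
      by (rule linear_mapsD(3)[OF AL[OF w]]) (simp_all add: s c)
    finally show "tensor_lift K (H p) (H p) (M q)
        (\<lambda>a b. ?m p (?r \<otimes>\<^bsub>Q\<^esub> q) a (?m ?r q (S p b) (act q \<one>\<^bsub>Q\<^esub> c w))) (\<Delta> p h) =
      \<epsilon> p h \<odot>\<^bsub>M q\<^esub> act q \<one>\<^bsub>Q\<^esub> c w" .
  qed
  show "tensor_lift K (H p) (H p) (M q)
      (\<lambda>a b. ?m ?r (p \<otimes>\<^bsub>Q\<^esub> q) (S p a) (?m p q b x)) (\<Delta> p h) = \<epsilon> p h \<odot>\<^bsub>M q\<^esub> x"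
  proof (rule coinvariant_span[OF q x component_module[OF q] _ R])
    show "(\<lambda>x. tensor_lift K (H p) (H p) (M q)
        (\<lambda>a b. ?m ?r (p \<otimes>\<^bsub>Q\<^esub> q) (S p a) (?m p q b x)) (\<Delta> p h)) \<in> linear_maps K (M q) (M q)"
      by (intro quasi_intros modified_action_linear_comp) (simp_all add: s)
    fix c w assume c: "c \<in> carrier (H q)" and w: "coinvariant w"
    \<comment> \<open>The same mechanism with \<open>S(a) (b c)\<close>, which calls for the first
      left antipode axiom.\<close>
    have "tensor_lift K (H p) (H p) (M q)
        (\<lambda>a b. ?m ?r (p \<otimes>\<^bsub>Q\<^esub> q) (S p a) (?m p q b (act q \<one>\<^bsub>Q\<^esub> c w))) (\<Delta> p h) =
      tensor_lift K (H p) (H p) (M q)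
        (\<lambda>a b. act q \<one>\<^bsub>Q\<^esub> (prd ?r (p \<otimes>\<^bsub>Q\<^esub> q) (S p a) (prd p q b c)) w) (\<Delta> p h)"
      by (rule tensor_lift_cong) (simp_all add: s c w modified_action_coinvariant)
    also have "\<dots> = act q \<one>\<^bsub>Q\<^esub> (tensor_lift K (H p) (H p) (H q)
        (\<lambda>a b. prd ?r (p \<otimes>\<^bsub>Q\<^esub> q) (S p a) (prd p q b c)) (\<Delta> p h)) w"
      by (rule tensor_lift_comp[OF _ _ _ _ _ AL[OF w], symmetric]; (intro quasi_intros)?)
        (simp_all add: s c)
    also have "\<dots> = \<epsilon> p h \<odot>\<^bsub>M q\<^esub> act q \<one>\<^bsub>Q\<^esub> c w"
      unfolding antipode_left_1[OF p q h c]
      by (rule linear_mapsD(3)[OF AL[OF w]]) (simp_all add: s c)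
    finally show "tensor_lift K (H p) (H p) (M q)
        (\<lambda>a b. ?m ?r (p \<otimes>\<^bsub>Q\<^esub> q) (S p a) (?m p q b (act q \<one>\<^bsub>Q\<^esub> c w))) (\<Delta> p h) =
      \<epsilon> p h \<odot>\<^bsub>M q\<^esub> act q \<one>\<^bsub>Q\<^esub> c w" .
  qed
  let ?pq = "p \<otimes>\<^bsub>Q\<^esub> q"
  define T where "T = tensor K (H ?pq) (M ?pq)"
  have mT: "module K T" by (simp add: T_def s)
  have "\<rho> ?pq (?m p q h x) = tensor_lift K (H p) (H p) T (\<lambda>h1 h2. tensor_lift K (H q) (M q) T
      (\<lambda>c y. pure K (H ?pq) (M ?pq) (prd p q h1 c) (?m p q h2 y)) (\<rho> q x)) (\<Delta> p h)"
  proof (rule coinvariant_span[OF q x mT])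
    show "(\<lambda>x. \<rho> ?pq (?m p q h x)) \<in> linear_maps K (M q) T"
      by (unfold T_def, intro quasi_intros modified_action_linear_comp) (simp_all add: s)
    show "(\<lambda>x. tensor_lift K (H p) (H p) T (\<lambda>h1 h2. tensor_lift K (H q) (M q) T
        (\<lambda>c y. pure K (H ?pq) (M ?pq) (prd p q h1 c) (?m p q h2 y)) (\<rho> q x)) (\<Delta> p h))
        \<in> linear_maps K (M q) T"
      by (unfold T_def, intro quasi_intros modified_action_linear_comp) (simp_all add: s)
    fix a w assume a: "a \<in> carrier (H q)" and w: "coinvariant w"
    then have w': "w \<in> carrier (M \<one>\<^bsub>Q\<^esub>)" by (auto simp: coinvariant_def)
    note s = s a w' mT
    let ?B = "\<lambda>u v. pure K (H ?pq) (M ?pq) u (act ?pq \<one>\<^bsub>Q\<^esub> v w)"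
    let ?THH = "tensor K (H ?pq) (H ?pq)"
    have B: "?B \<in> bilinear_maps K (H ?pq) (H ?pq) T"
      by (unfold T_def, intro quasi_intros) (simp_all add: s)
    have L: "tensor_lift K (H ?pq) (H ?pq) T ?B \<in> linear_maps K ?THH T"
      by (rule tensor_lift_linear[OF _ _ _ B]) (simp_all add: s)
    \<comment> \<open>Since \<open>w\<close> is coinvariant, the coaction of
      \<open>(h a) \<cdot> w\<close> is the image of \<open>\<Delta>(h a)\<close> under
      \<open>u \<otimes> v \<mapsto> u \<otimes> v \<cdot> w\<close>. Compatibility is thus
      multiplicativity of \<open>\<Delta>\<close>.\<close>
    have "\<rho> ?pq (?m p q h (act q \<one>\<^bsub>Q\<^esub> a w)) =
        tensor_lift K (H ?pq) (H ?pq) T ?B (\<Delta> ?pq (prd p q h a))"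
      by (simp add: s w modified_action_coinvariant coaction_coinvariant T_def)
    also have "\<dots> = tensor_lift K (H p) (H p) T (\<lambda>h1 h2. tensor_lift K (H ?pq) (H ?pq) T ?B
        (tensor_lift K (H q) (H q) ?THH
          (\<lambda>a1 a2. pure K (H ?pq) (H ?pq) (prd p q h1 a1) (prd p q h2 a2)) (\<Delta> q a))) (\<Delta> p h)"
      unfolding comult_prd[OF p q h a]
      by (rule tensor_lift_comp[OF _ _ _ _ _ L]; (intro quasi_intros)?) (simp_all add: s)
    also have "\<dots> = tensor_lift K (H p) (H p) T (\<lambda>h1 h2. tensor_lift K (H q) (H q) T
        (\<lambda>a1 a2. tensor_lift K (H ?pq) (H ?pq) T ?B
          (pure K (H ?pq) (H ?pq) (prd p q h1 a1) (prd p q h2 a2))) (\<Delta> q a)) (\<Delta> p h)"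
      by (rule tensor_lift_cong[OF refl refl refl refl],
          rule tensor_lift_comp[OF _ _ _ _ _ L]; (intro quasi_intros)?) (simp_all add: s)
    also have "\<dots> = tensor_lift K (H p) (H p) T (\<lambda>h1 h2. tensor_lift K (H q) (H q) T
        (\<lambda>a1 a2. pure K (H ?pq) (M ?pq) (prd p q h1 a1) (?m p q h2 (act q \<one>\<^bsub>Q\<^esub> a2 w)))
          (\<Delta> q a)) (\<Delta> p h)"
      by (intro tensor_lift_cong refl, subst tensor_lift_pure[OF _ _ _ B])
        (simp_all add: s w modified_action_coinvariant)
    \<comment> \<open>The coaction formula for \<open>a \<cdot> w\<close> is read backwards,
      replacing the coproduct of \<open>a\<close> by the coaction.\<close>
    also have "\<dots> = tensor_lift K (H p) (H p) T (\<lambda>h1 h2. tensor_lift K (H q) (M q) T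
        (\<lambda>c y. pure K (H ?pq) (M ?pq) (prd p q h1 c) (?m p q h2 y))
          (\<rho> q (act q \<one>\<^bsub>Q\<^esub> a w))) (\<Delta> p h)"
      by (rule tensor_lift_cong[OF refl refl refl refl],
          rule coaction_coinvariant_lift[OF q a w mT, symmetric];
          (unfold T_def, intro quasi_intros modified_action_linear_comp)?) (simp_all add: s)
    finally show "\<rho> ?pq (?m p q h (act q \<one>\<^bsub>Q\<^esub> a w)) =
      tensor_lift K (H p) (H p) T (\<lambda>h1 h2. tensor_lift K (H q) (M q) T
        (\<lambda>c y. pure K (H ?pq) (M ?pq) (prd p q h1 c) (?m p q h2 y))
          (\<rho> q (act q \<one>\<^bsub>Q\<^esub> a w))) (\<Delta> p h)" .
  qed
  then show "\<rho> ?pq (?m p q h x) = (let T = tensor K (H ?pq) (M ?pq) in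
      tensor_lift K (H p) (H p) T (\<lambda>h1 h2. tensor_lift K (H q) (M q) T
        (\<lambda>c y. pure K (H ?pq) (M ?pq) (prd p q h1 c) (?m p q h2 y)) (\<rho> q x)) (\<Delta> p h))"
    by (simp add: T_def Let_def)
qed

end

theorem theorem4p8:
  fixes Q :: "('q, 'y) monoid_scheme" and K :: "('k, 'z) ring_scheme"
    and H :: "'q \<Rightarrow> ('k, 'h) module" and M :: "'q \<Rightarrow> ('k, 'm) module"
  assumes "quasigroup Q"
    and "field K"
    and "graded_hopf_quasigroup Q K H m \<mu> \<Delta> \<epsilon> S"
    and "graded_hopf_quasimodule Q K H m \<mu> \<Delta> \<epsilon> S M \<phi> \<rho>"
  shows "graded_hopf_quasimodule Q K H m \<mu> \<Delta> \<epsilon> S M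
           (graded_hopf_quasimodule.modified_action Q K H m \<Delta> S M \<phi> \<rho>) \<rho>"
  by (rule graded_hopf_quasimodule.modified_action_hopf_quasimodule[OF assms(4)])

end
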